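(* For every integer $M\ge1$, $$\mathcal{Y}(z;t)\,\mathcal{Y}(w;t^M)=\frac{(w/z;t)_M}{(-w/z;t)_M}\;:\!\mathcal{Y}(z;t)\mathcal{Y}(w;t^M)\!:\,.$$ Equivalently, $$F_{t,t^M}(u)=\prod_{j=0}^{M-1}\frac{1-t^ju}{1+t^ju}=\frac{(u;t)_M}{(-u;t)_M}.$$
   Context: Let $t$ be an indeterminate and let operators act on $\Gamma_{\mathbb{Q}(t)}=\mathbb{Q}(t)[p_1,p_3,p_5,\ldots]$. For odd $n\ge1$, $a_{-n}$ is multiplication by $p_n$ and $a_n=\frac n2\frac{\partial}{\partial p_n}$. For a parameter $s$ (here $s=t$ or $s=t^M$) set $$A_s(z)=\sum_{n\ge1,\ n\text{ odd}}\frac{2(1-s^n)}{n}a_{-n}z^n,\qquad B_s(z)=-\sum_{n\ge1,\ n\text{ odd}}\frac{2}{n(1-s^n)}a_nz^{-n},$$ and $\mathcal{Y}(z;s)=e^{A_s(z)}e^{B_s(z)}$, a formal series in $z^{\pm1}$ with operator coefficients. The normally ordered product is $$:\!\mathcal{Y}(z;t)\mathcal{Y}(w;s)\!:\;=e^{A_t(z)+A_s(w)}e^{B_t(z)+B_s(w)}.$$ Further, $$F_{t,s}(u)=\exp\Big(-2\sum_{n\ge1,\ n\text{ odd}}\frac{1-s^n}{1-t^n}\frac{u^n}{n}\Big),$$ which is the scalar factor in $\mathcal{Y}(z;t)\mathcal{Y}(w;s)=F_{t,s}(w/z):\!\mathcal{Y}(z;t)\mathcal{Y}(w;s)\!:$.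 The Pochhammer symbol is $(a;t)_M=\prod_{j=0}^{M-1}(1-at^j)$. Scalar factors are expanded as formal power series in $w/z$. *)

theory Defs
  imports
    "HOL-Computational_Algebra.Computational_Algebra"
    "HOL-Library.Poly_Mapping"
    "HOL-Library.Groups_Big_Fun"
    "HOL-Library.Product_Plus"
begin

type_synonym Qt = "rat poly fract"

definition indet :: Qt where
  "indet = to_fract [:0, 1:]"

text \<open>
  The ring \<open>\<Gamma> = \<rat>(t)[p\<^sub>1, p\<^sub>3, p\<^sub>5, \<dots>]\<close> is the algebra of the free commutative monoid on
  \<open>nat\<close>, with generator \<open>k\<close> standing for \<open>p\<^bsub>2k+1\<^esub>\<close>; the product on \<open>poly_mapping\<close> is convolution.
  Thus \<open>p\<^sub>n\<close> with \<open>n\<close> odd is the generator \<open>n div 2\<close>.  Every use below is at odd \<open>n\<close>.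
\<close>

type_synonym Gam = "(nat \<Rightarrow>\<^sub>0 nat) \<Rightarrow>\<^sub>0 Qt"

definition pvar :: "nat \<Rightarrow> Gam" where
  "pvar n = Poly_Mapping.single (Poly_Mapping.single (n div 2) 1) 1"

definition scal :: "Qt \<Rightarrow> Gam \<Rightarrow> Gam" where
  "scal c f = Poly_Mapping.single 0 c * f"

text \<open>
  Formal partial derivative with respect to \<open>p\<^sub>n\<close>, monomial by monomial.  The subtraction of
  exponents truncates exactly when the exponent of \<open>p\<^sub>n\<close> is 0, and then the coefficient is 0.
\<close>

definition dp :: "nat \<Rightarrow> Gam \<Rightarrow> Gam" where
  "dp n f = (\<Sum>m\<in>Poly_Mapping.keys f.
     Poly_Mapping.single (m - Poly_Mapping.single (n div 2) 1)
       (of_nat (Poly_Mapping.lookup m (n div 2)) * Poly_Mapping.lookup f m))"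

definition a_op :: "int \<Rightarrow> Gam \<Rightarrow> Gam" where
  "a_op n f = (if n < 0 then pvar (nat (- n)) * f else scal (of_int n / 2) (dp (nat n) f))"

text \<open>
  Formal series (infinite in both directions) with coefficients operators on \<open>\<Gamma>\<close>.  The group
  \<open>'e\<close> is that of the exponents: \<open>int\<close> for series in \<open>z\<^sup>\<plusminus>\<^sup>1\<close>, and \<open>int \<times> int\<close> for
  series in \<open>z\<^sup>\<plusminus>\<^sup>1, w\<^sup>\<plusminus>\<^sup>1\<close>, where \<open>(i, j)\<close> stands for \<open>z\<^sup>i w\<^sup>j\<close>.

  Infinite sums of operators are meant pointwise: applied to a fixed \<open>f\<close>, only finitely many summands
  are nonzero, and \<open>Sum_any\<close> adds those.  (On infinite supports \<open>Sum_any\<close> is 0 by convention, but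
  this does not occur for the series considered: \<open>A\<^sub>s(z)\<close> involves only positive powers and \<open>B\<^sub>s(z)\<close> only
  negative ones, while a product of annihilation operators whose degree exceeds that of \<open>f\<close>,
  where \<open>p\<^sub>n\<close> has degree \<open>n\<close>, kills \<open>f\<close>.)
\<close>

type_synonym 'e opser = "'e \<Rightarrow> Gam \<Rightarrow> Gam"

definition ser_one :: "'e::ab_group_add opser" where
  "ser_one e f = (if e = 0 then f else 0)"

definition ser_add :: "'e opser \<Rightarrow> 'e opser \<Rightarrow> 'e opser" (infixl \<open>\<oplus>\<close> 65) where
  "(X \<oplus> Y) e f = X e f + Y e f"

definition ser_mult :: "'e::ab_group_add opser \<Rightarrow> 'e opser \<Rightarrow> 'e opser" (infixl \<open>\<odot>\<close> 70) where
  "(X \<odot> Y) e f = Sum_any (\<lambda>d. X (e - d) (Y d f))"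

primrec ser_pow :: "'e::ab_group_add opser \<Rightarrow> nat \<Rightarrow> 'e opser" where
  "ser_pow X 0 = ser_one"
| "ser_pow X (Suc k) = X \<odot> ser_pow X k"

definition ser_exp :: "'e::ab_group_add opser \<Rightarrow> 'e opser" where
  "ser_exp X e f = Sum_any (\<lambda>k. scal (1 / fact k) (ser_pow X k e f))"

definition A_ser :: "Qt \<Rightarrow> int opser" where
  "A_ser s i f = (if i > 0 \<and> odd i
     then scal (2 * (1 - s ^ nat i) / of_int i) (a_op (- i) f) else 0)"

definition B_ser :: "Qt \<Rightarrow> int opser" where
  "B_ser s i f = (if i < 0 \<and> odd i
     then let n = - i in scal (- (2 / (of_int n * (1 - s ^ nat n)))) (a_op n f) else 0)"

definition Y_ser :: "Qt \<Rightarrow> int opser" where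
  "Y_ser s = ser_exp (A_ser s) \<odot> ser_exp (B_ser s)"

definition in_z :: "int opser \<Rightarrow> (int \<times> int) opser" where
  "in_z X = (\<lambda>(i, j) f. if j = 0 then X i f else 0)"

definition in_w :: "int opser \<Rightarrow> (int \<times> int) opser" where
  "in_w X = (\<lambda>(i, j) f. if i = 0 then X j f else 0)"

definition normal_YY :: "Qt \<Rightarrow> Qt \<Rightarrow> (int \<times> int) opser" where
  "normal_YY t s =
     ser_exp (in_z (A_ser t) \<oplus> in_w (A_ser s)) \<odot> ser_exp (in_z (B_ser t) \<oplus> in_w (B_ser s))"

text \<open>Scalar factors \<open>G(w/z)\<close> are expanded in powers of \<open>w/z\<close>: \<open>u\<^sup>m\<close> becomes \<open>z\<^bsup>-m\<^esup> w\<^sup>m\<close>.\<close>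

definition at_w_over_z :: "Qt fps \<Rightarrow> (int \<times> int) opser" where
  "at_w_over_z G = (\<lambda>(i, j) f. if j \<ge> 0 \<and> i = - j then scal (fps_nth G (nat j)) f else 0)"

definition F_ser :: "Qt \<Rightarrow> Qt \<Rightarrow> Qt fps" where
  "F_ser t s = fps_compose (fps_exp 1)
     (fps_const (- 2) * Abs_fps (\<lambda>n. if odd n then (1 - s ^ n) / (1 - t ^ n) / of_nat n else 0))"

definition qpoch :: "'a::comm_ring_1 \<Rightarrow> 'a \<Rightarrow> nat \<Rightarrow> 'a" where
  "qpoch x q M = (\<Prod>j<M. 1 - x * q ^ j)"

end

theory Submission
  imports Defs
begin

text \<open>
  Write \<open>C(u) = log F\<^bsub>t,s\<^esub>(u)\<close>.  The relation \<open>[\<partial>/\<partial>p\<^sub>n, p\<^sub>k] = \<delta>\<^sub>n\<^sub>k\<close> gives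
  \<open>[B\<^sub>t(z), A\<^sub>s(w)] = C(w/z)\<close>, a scalar, and hence
  \<open>e\<^bsup>B\<^sub>t(z)\<^esup> e\<^bsup>A\<^sub>s(w)\<^esup> = F\<^bsub>t,s\<^esub>(w/z) e\<^bsup>A\<^sub>s(w)\<^esup> e\<^bsup>B\<^sub>t(z)\<^esup>\<close>.  As the \<open>A\<close>-series commute among themselves, and so do the
  \<open>B\<close>-series, \<open>exp\<close> turns their sums into products, and
  \<open>\<Y>(z;t) \<Y>(w;s) = F\<^bsub>t,s\<^esub>(w/z) :\<Y>(z;t) \<Y>(w;s):\<close> holds for all \<open>t\<close> and \<open>s\<close> (\<open>vertex_operator_product\<close>).
  For \<open>s = t\<^sup>M\<close> the quotient \<open>(1 - t\<^bsup>Mn\<^esup>) / (1 - t\<^sup>n)\<close> is a geometric sum, so \<open>C(u)\<close> is a sum over \<open>j < M\<close> of the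
  series \<open>-2 \<Sum>\<^bsub>n odd\<^esub> (t\<^sup>j u)\<^sup>n / n = log ((1 - t\<^sup>j u) / (1 + t\<^sup>j u))\<close>, which gives the product formula for \<open>F\<close>
  (\<open>F_ser_indet\<close>).

  Every exponential enters the argument through its Euler recursion: if \<open>E = exp X\<close> and the coefficients
  of \<open>X\<close> commute, then \<open>n E\<^sub>n = \<Sum>\<^sub>k k X\<^sub>k E\<^bsub>n-k\<^esub>\<close> (\<open>exp_euler\<close>).  With it, \<open>exp (X + Y) = exp X exp Y\<close> is a
  consequence of the uniqueness of solutions (\<open>exp_add\<close>), and the exchange of \<open>e\<^sup>B\<close> and \<open>e\<^sup>A\<close> becomes an
  induction on coefficients (\<open>annihilator_exp\<close>, \<open>exp_exchange\<close>), with finite sums throughout.  The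
  infinite sums over exponents are finite on each \<open>f\<close> because annihilation operators lower the degree
  (\<open>EB_vanish\<close>).
\<close>

section \<open>Linear operators and derivations of the polynomial ring\<close>

interpretation gam: module scal
  by standard
    (simp_all add: scal_def algebra_simps single_add mult_single flip: mult.assoc)

text \<open>
  Linear endomorphisms of \<open>\<Gamma>\<close>, the coefficients of all operator series below.
\<close>

abbreviation glin :: "(Gam \<Rightarrow> Gam) \<Rightarrow> bool" where
  "glin \<equiv> module_hom scal scal"

lemma glinI:
  assumes "\<And>f g. L (f + g) = L f + L g" "\<And>c f. L (scal c f) = scal c (L f)"
  shows "glin L"
  using assms by (simp add: module_hom_iff gam.module_axioms)

lemma glin_plus: "glin L \<Longrightarrow> L (f + g) = L f + L g"
  by (rule module_hom.add)

lemma glin_scale: "glin L \<Longrightarrow> L (scal c f) = scal c (L f)"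
  by (rule module_hom.scale)

lemma glin_at_zero: "glin L \<Longrightarrow> L 0 = 0"
  by (rule module_hom.zero)

lemma glin_of_sum: "glin L \<Longrightarrow> L (sum h S) = (\<Sum>x\<in>S. L (h x))"
  by (rule module_hom.sum)

lemma glin_id: "glin (\<lambda>f. f)"
  by (rule glinI) simp_all

lemma glin_zero: "glin (\<lambda>f. 0)"
  by (rule glinI) simp_all

lemma glin_if: "glin L \<Longrightarrow> glin (\<lambda>f. if b then L f else 0)"
  by (cases b) (simp_all add: glin_zero)

lemma glin_scal: "glin L \<Longrightarrow> glin (\<lambda>f. scal c (L f))"
  by (rule glinI)
    (simp_all add: glin_plus glin_scale gam.scale_right_distrib mult.commute)

lemma glin_add: "glin L \<Longrightarrow> glin K \<Longrightarrow> glin (\<lambda>f. L f + K f)"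
  by (rule glinI) (simp_all add: glin_plus glin_scale gam.scale_right_distrib)

lemma glin_comp: "glin L \<Longrightarrow> glin K \<Longrightarrow> glin (\<lambda>f. L (K f))"
  by (rule glinI) (simp_all add: glin_plus glin_scale)

lemma glin_sum: "(\<And>x. x \<in> S \<Longrightarrow> glin (L x)) \<Longrightarrow> glin (\<lambda>f. \<Sum>x\<in>S. L x f)"
  by (rule glinI)
    (simp_all add: glin_plus glin_scale gam.scale_sum_right flip: sum.distrib)

lemma scal_single: "scal c (Poly_Mapping.single m x) = Poly_Mapping.single m (c * x)"
  by (simp add: scal_def mult_single)

lemma glin_mult: "glin (\<lambda>f. p * f)"
  by (rule glinI) (simp_all add: scal_def algebra_simps)

lemma gam_induct [case_names single add]:
  fixes f :: Gam
  assumes single: "\<And>m c. P (Poly_Mapping.single m c)"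
    and add: "\<And>f g. P f \<Longrightarrow> P g \<Longrightarrow> P (f + g)"
  shows "P f"
proof (induction f rule: update_induct)
  case const
  show ?case using single[of 0 0] by simp
next
  case (update f a b)
  have "Poly_Mapping.update a b f = Poly_Mapping.single a b + f"
    using update(1)
    by (intro poly_mapping_eqI)
      (auto simp: lookup_update lookup_add lookup_single when_def in_keys_iff)
  with update(3) show ?case by (simp add: add single)
qed

lemma dp_add: "dp n (f + g) = dp n f + dp n g"
  unfolding dp_def
  by (rule setsum_keys_plus_distrib) (simp_all add: algebra_simps single_add)

lemma dp_single:
  "dp n (Poly_Mapping.single m c) =
     Poly_Mapping.single (m - Poly_Mapping.single (n div 2) 1)
       (of_nat (Poly_Mapping.lookup m (n div 2)) * c)"
  by (cases "c = 0") (simp_all add: dp_def)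

lemma glin_dp: "glin (dp n)"
proof (rule glinI)
  show "dp n (scal c f) = scal c (dp n f)" for c f
    by (induction f rule: gam_induct)
      (simp_all add: dp_add dp_single scal_single gam.scale_right_distrib algebra_simps)
qed (rule dp_add)

lemma dp_commute: "dp n (dp k f) = dp k (dp n f)"
proof (induction f rule: gam_induct)
  case (single m c)
  have "m - Poly_Mapping.single (k div 2) 1 - Poly_Mapping.single (n div 2) 1 =
        m - Poly_Mapping.single (n div 2) 1 - Poly_Mapping.single (k div 2) (1::nat)"
    by (intro poly_mapping_eqI) (simp add: lookup_minus)
  then show ?case
    by (cases "n div 2 = k div 2")
      (auto simp: dp_single lookup_minus lookup_single when_def algebra_simps)
qed (simp add: dp_add)

text \<open>The Heisenberg relation \<open>[\<partial>/\<partial>p\<^sub>n, p\<^sub>k] = \<delta>\<^sub>n\<^sub>k\<close>.\<close>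

lemma dp_pvar_mult:
  assumes "odd n" "odd k"
  shows "dp n (pvar k * f) = (if k = n then f else 0) + pvar k * dp n f"
proof (induction f rule: gam_induct)
  case (single m c)
  have kn: "k div 2 = n div 2 \<longleftrightarrow> k = n"
    using assms by (auto elim!: oddE)
  have shift: "Poly_Mapping.single (k div 2) 1 + m - Poly_Mapping.single (n div 2) 1 =
      Poly_Mapping.single (k div 2) 1 + (m - Poly_Mapping.single (n div 2) (1::nat))"
    if "Poly_Mapping.lookup m (n div 2) > 0"
    using that
    by (intro poly_mapping_eqI) (auto simp add: lookup_minus lookup_add lookup_single when_def)
  show ?case
  proof (cases "Poly_Mapping.lookup m (n div 2) = 0")
    case True
    then show ?thesis
      using kn by (auto simp: dp_single pvar_def mult_single lookup_add lookup_single when_def)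
  next
    case False
    then show ?thesis
      using kn shift
      by (auto simp: dp_single pvar_def mult_single lookup_add lookup_single when_def
          single_add[symmetric] algebra_simps)
  qed
qed (simp add: dp_add algebra_simps)

section \<open>The degree filtration\<close>

text \<open>
  The grading of \<open>\<Gamma>\<close> in which \<open>p\<^sub>n\<close> has degree \<open>n\<close>, on monomials: generator \<open>k\<close> stands for
  \<open>p\<^bsub>2k+1\<^esub>\<close> and so has weight \<open>2k + 1\<close>.
\<close>

definition wdeg :: "(nat \<Rightarrow>\<^sub>0 nat) \<Rightarrow> nat" where
  "wdeg m = (\<Sum>k\<in>Poly_Mapping.keys m. (2 * k + 1) * Poly_Mapping.lookup m k)"

lemma wdeg_add: "wdeg (m + m') = wdeg m + wdeg m'"
  unfolding wdeg_def by (rule setsum_keys_plus_distrib) (simp_all add: algebra_simps)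

lemma wdeg_single: "wdeg (Poly_Mapping.single k a) = (2 * k + 1) * a"
  by (simp add: wdeg_def)

text \<open>
  The elements of degree at most \<open>d\<close>.  The bound is an integer, so that \<open>\<partial>/\<partial>p\<^sub>n\<close> always lowers it
  by \<open>n\<close>; for \<open>d < 0\<close> only \<open>0\<close> is left.
\<close>

definition deg_le :: "int \<Rightarrow> Gam set" where
  "deg_le d = {f. \<forall>m\<in>Poly_Mapping.keys f. int (wdeg m) \<le> d}"

lemma deg_le_zero [simp]: "0 \<in> deg_le d"
  by (simp add: deg_le_def)

lemma deg_le_add: "f \<in> deg_le d \<Longrightarrow> g \<in> deg_le d \<Longrightarrow> f + g \<in> deg_le d"
  using Poly_Mapping.keys_add[of f g] by (auto simp: deg_le_def)

lemma deg_le_sum: "(\<And>x. x \<in> S \<Longrightarrow> f x \<in> deg_le d) \<Longrightarrow> sum f S \<in> deg_le d"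
  by (induction S rule: infinite_finite_induct) (auto intro: deg_le_add)

lemma deg_le_scal: 
  assumes "f \<in> deg_le d"
  shows "scal c f \<in> deg_le d"
proof -
  have "Poly_Mapping.lookup (scal c f) m = c * Poly_Mapping.lookup f m" for m
    by (induction f rule: gam_induct)
      (simp_all add: scal_single gam.scale_right_distrib lookup_add lookup_single when_def algebra_simps)
  then show ?thesis using assms by (auto simp: deg_le_def in_keys_iff)
qed

lemma deg_le_negative: "f \<in> deg_le d \<Longrightarrow> d < 0 \<Longrightarrow> f = 0"
  by (force simp: deg_le_def simp flip: keys_eq_empty)

lemma deg_le_exists: "\<exists>d\<ge>0. f \<in> deg_le d"
proof (induction f rule: gam_induct)
  case (single m c)
  show ?case by (rule exI[of _ "int (wdeg m)"]) (simp add: deg_le_def)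
next
  case (add f g)
  then obtain d e where "d \<ge> 0" "f \<in> deg_le d" "e \<ge> 0" "g \<in> deg_le e" by blast
  then have "f \<in> deg_le (max d e)" "g \<in> deg_le (max d e)" by (auto simp: deg_le_def)
  with \<open>d \<ge> 0\<close> show ?case by (intro exI[of _ "max d e"]) (auto intro: deg_le_add)
qed

lemma deg_le_dp:
  assumes "odd n" "f \<in> deg_le d"
  shows "dp n f \<in> deg_le (d - int n)"
  unfolding dp_def
proof (rule deg_le_sum)
  fix m assume m: "m \<in> Poly_Mapping.keys f"
  let ?e = "Poly_Mapping.single (n div 2) (1::nat)"
  show "Poly_Mapping.single (m - ?e) (of_nat (Poly_Mapping.lookup m (n div 2)) * Poly_Mapping.lookup f m)
      \<in> deg_le (d - int n)"
  proof (cases "Poly_Mapping.lookup m (n div 2) = 0")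
    case False
    then have "m = (m - ?e) + ?e"
      by (intro poly_mapping_eqI) (auto simp: lookup_add lookup_minus lookup_single when_def)
    then have "wdeg m = wdeg (m - ?e) + wdeg ?e" by (metis wdeg_add)
    moreover have "wdeg ?e = n" using \<open>odd n\<close> by (simp add: wdeg_single)
    moreover have "int (wdeg m) \<le> d" using assms m by (auto simp: deg_le_def)
    ultimately show ?thesis by (simp add: deg_le_def)
  qed simp
qed

section \<open>Operator series supported in a cone, and their exponentials\<close>

text \<open>
  All coefficients of one series commute with all coefficients of the other.
\<close>

definition commuting :: "'e opser \<Rightarrow> 'd opser \<Rightarrow> bool" where
  "commuting X Y \<longleftrightarrow> (\<forall>a b f. X a (Y b f) = Y b (X a f))"

lemma commutingD: "commuting X Y \<Longrightarrow> X a (Y b f) = Y b (X a f)"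
  by (simp add: commuting_def)

text \<open>
  A monoid \<open>C\<close> of exponents inside the group of all exponents, with only finitely many
  decompositions of each exponent into two elements of \<open>C\<close>, and a weight that is additive and
  positive on \<open>C - {0}\<close>.  Series supported in \<open>C\<close> multiply by finite sums, and those without constant
  term can be exponentiated.
\<close>

locale cone =
  fixes C :: "'e::ab_group_add set" and wt :: "'e \<Rightarrow> int"
  assumes zero_mem: "0 \<in> C"
    and add_mem: "a \<in> C \<Longrightarrow> b \<in> C \<Longrightarrow> a + b \<in> C"
    and finite_splits': "finite {d \<in> C. e - d \<in> C}"
    and wt_add: "wt (a + b) = wt a + wt b"
    and wt_pos: "d \<in> C \<Longrightarrow> d \<noteq> 0 \<Longrightarrow> wt d > 0"
begin

text \<open>
  The exponents \<open>d\<close> of the right factor in the coefficient of exponent \<open>e\<close> of a product.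
\<close>

definition splits :: "'e \<Rightarrow> 'e set" where
  "splits e = {d \<in> C. e - d \<in> C}"

text \<open>
  Series of linear operators supported in \<open>C\<close>.
\<close>

definition ser :: "'e opser \<Rightarrow> bool" where
  "ser X \<longleftrightarrow> (\<forall>d. glin (X d)) \<and> (\<forall>d f. d \<notin> C \<longrightarrow> X d f = 0)"

text \<open>
  The Euler derivation of the ring of series: it multiplies the coefficient of exponent \<open>d\<close> by the
  weight of \<open>d\<close>.
\<close>

definition euler :: "'e opser \<Rightarrow> 'e opser" where
  "euler X d f = scal (of_int (wt d)) (X d f)"

lemma finite_splits: "finite (splits e)"
  by (simp add: splits_def finite_splits')

lemma wt_zero: "wt 0 = 0"
  using wt_add[of 0 0] by simp

lemma wt_diff: "wt (a - b) = wt a - wt b"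
  using wt_add[of "a - b" b] by simp

lemma wt_nonneg: "d \<in> C \<Longrightarrow> wt d \<ge> 0"
  using wt_pos[of d] by (cases "d = 0") (auto simp: wt_zero)

lemma splits_outside: "e \<notin> C \<Longrightarrow> splits e = {}"
  using add_mem by (force simp: splits_def)

lemma splits_zero: "splits 0 = {0}"
proof -
  have "d = 0" if "d \<in> C" "- d \<in> C" for d
    using that wt_pos[of d] wt_nonneg[of "- d"] wt_diff[of 0 d] wt_zero by fastforce
  then show ?thesis using zero_mem by (auto simp: splits_def)
qed

lemma serI:
  "(\<And>d. glin (X d)) \<Longrightarrow> (\<And>d f. d \<notin> C \<Longrightarrow> X d f = 0) \<Longrightarrow> ser X"
  by (simp add: ser_def)

lemma ser_glin: "ser X \<Longrightarrow> glin (X d)"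
  by (simp add: ser_def)

lemma ser_outside: "ser X \<Longrightarrow> d \<notin> C \<Longrightarrow> X d f = 0"
  by (simp add: ser_def)

lemma ser_arg_zero: "ser X \<Longrightarrow> X d 0 = 0"
  by (metis ser_glin glin_at_zero)

lemma ser_arg_scal: "ser X \<Longrightarrow> X d (scal c f) = scal c (X d f)"
  by (metis ser_glin glin_scale)

lemma ser_arg_add: "ser X \<Longrightarrow> X d (f + g) = X d f + X d g"
  by (metis ser_glin glin_plus)

lemma ser_arg_sum: "ser X \<Longrightarrow> X d (sum h S) = (\<Sum>x\<in>S. X d (h x))"
  by (metis ser_glin glin_of_sum)

lemma mult_eq:
  assumes "ser X" "ser Y"
  shows "(X \<odot> Y) e f = (\<Sum>d\<in>splits e. X (e - d) (Y d f))"
  unfolding ser_mult_def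
proof (rule Sum_any.expand_superset)
  show "{d. X (e - d) (Y d f) \<noteq> 0} \<subseteq> splits e"
    using assms by (auto simp: splits_def dest: ser_outside) (metis ser_outside ser_arg_zero)
qed (rule finite_splits)

lemma ser_ser_mult:
  assumes "ser X" "ser Y"
  shows "ser (X \<odot> Y)"
proof (rule serI)
  have "glin (\<lambda>f. \<Sum>d\<in>splits e. X (e - d) (Y d f))" for e
    by (rule glin_sum) (rule glin_comp[OF ser_glin[OF assms(1)] ser_glin[OF assms(2)]])
  then show "glin ((X \<odot> Y) e)" for e
    using mult_eq[OF assms, of e] by presburger
  show "(X \<odot> Y) d f = 0" if "d \<notin> C" for d f
    using that by (simp add: mult_eq assms splits_outside)
qed

lemma ser_ser_add: "ser X \<Longrightarrow> ser Y \<Longrightarrow> ser (X \<oplus> Y)"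
  unfolding ser_def ser_add_def[abs_def] by (simp add: glin_add)

lemma ser_ser_one: "ser ser_one"
proof (rule serI)
  show "glin (ser_one d)" for d :: 'e
    by (cases "d = 0") (simp_all add: ser_one_def[abs_def] glin_id glin_zero)
qed (use zero_mem in \<open>auto simp: ser_one_def\<close>)

lemma ser_euler: "ser X \<Longrightarrow> ser (euler X)"
  unfolding ser_def euler_def[abs_def] by (simp add: glin_scal)

lemma ser_ser_pow: "ser X \<Longrightarrow> ser (ser_pow X k)"
  by (induction k) (simp_all add: ser_ser_one ser_ser_mult)

lemma mult_assoc:
  assumes "ser X" "ser Y" "ser Z"
  shows "(X \<odot> Y) \<odot> Z = X \<odot> (Y \<odot> Z)"
proof (intro ext)
  fix e f
  have "((X \<odot> Y) \<odot> Z) e f =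
      (\<Sum>c\<in>splits e. \<Sum>d\<in>splits (e - c). X (e - c - d) (Y d (Z c f)))"
    using assms by (simp add: mult_eq ser_ser_mult)
  also have "\<dots> = (\<Sum>d\<in>splits e. \<Sum>c\<in>splits d. X (e - d) (Y (d - c) (Z c f)))"
    unfolding sum.Sigma[OF finite_splits ballI[OF finite_splits]]
  proof (rule sum.reindex_bij_witness[of _ "\<lambda>(d, c). (c, d - c)" "\<lambda>(c, d). (c + d, c)"])
    show "(case p of (c, d) \<Rightarrow> (c + d, c)) \<in> (SIGMA x:splits e. splits x)"
      if "p \<in> (SIGMA x:splits e. splits (e - x))" for p
      using that add_mem by (auto simp: splits_def algebra_simps)
    show "(case p of (d, c) \<Rightarrow> (c, d - c)) \<in> (SIGMA x:splits e. splits (e - x))"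
      if "p \<in> (SIGMA x:splits e. splits x)" for p
      using that add_mem[of "e - fst p" "fst p - snd p"] by (auto simp: splits_def algebra_simps)
  qed (auto simp: algebra_simps)
  also have "\<dots> = (X \<odot> (Y \<odot> Z)) e f"
    using assms by (simp add: mult_eq ser_ser_mult ser_arg_sum)
  finally show "((X \<odot> Y) \<odot> Z) e f = (X \<odot> (Y \<odot> Z)) e f" .
qed

lemma mult_left_commute:
  assumes "ser X" "ser Y" "ser Z" "commuting X Y"
  shows "X \<odot> (Y \<odot> Z) = Y \<odot> (X \<odot> Z)"
proof (intro ext)
  fix e f
  have "(X \<odot> (Y \<odot> Z)) e f = (\<Sum>d\<in>splits e. \<Sum>c\<in>splits d. X (e - d) (Y (d - c) (Z c f)))"
    using assms by (simp add: mult_eq ser_ser_mult ser_arg_sum)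
  also have "\<dots> = (\<Sum>d\<in>splits e. \<Sum>c\<in>splits d. Y (e - d) (X (d - c) (Z c f)))"
    unfolding sum.Sigma[OF finite_splits ballI[OF finite_splits]]
  proof (rule sum.reindex_bij_witness[of _ "\<lambda>(d, c). (e - d + c, c)" "\<lambda>(d, c). (e - d + c, c)"])
    show "(case p of (d, c) \<Rightarrow> (e - d + c, c)) \<in> (SIGMA x:splits e. splits x)"
      if "p \<in> (SIGMA x:splits e. splits x)" for p
      using that add_mem by (auto simp: splits_def)
    then show "(case p of (d, c) \<Rightarrow> (e - d + c, c)) \<in> (SIGMA x:splits e. splits x)"
      if "p \<in> (SIGMA x:splits e. splits x)" for p
      using that .
  qed (auto simp: algebra_simps commutingD[OF assms(4)])
  also have "\<dots> = (Y \<odot> (X \<odot> Z)) e f"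
    using assms by (simp add: mult_eq ser_ser_mult ser_arg_sum)
  finally show "(X \<odot> (Y \<odot> Z)) e f = (Y \<odot> (X \<odot> Z)) e f" .
qed

lemma mult_add_left:
  assumes "ser X" "ser Y" "ser Z"
  shows "(X \<oplus> Y) \<odot> Z = X \<odot> Z \<oplus> Y \<odot> Z"
  using assms
  by (intro ext) (simp add: mult_eq ser_ser_add ser_add_def sum.distrib)

lemma euler_mult:
  assumes "ser X" "ser Y"
  shows "euler (X \<odot> Y) = euler X \<odot> Y \<oplus> X \<odot> euler Y"
proof (intro ext)
  fix e f
  have "euler (X \<odot> Y) e f =
      (\<Sum>d\<in>splits e. scal (of_int (wt (e - d)) + of_int (wt d)) (X (e - d) (Y d f)))"
    using assms by (simp add: euler_def mult_eq gam.scale_sum_right wt_diff)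
  also have "\<dots> = (euler X \<odot> Y \<oplus> X \<odot> euler Y) e f"
    using assms
    by (simp add: ser_add_def mult_eq ser_euler euler_def ser_arg_scal gam.scale_left_distrib
        sum.distrib)
  finally show "euler (X \<odot> Y) e f = (euler X \<odot> Y \<oplus> X \<odot> euler Y) e f" .
qed

lemma euler_add: "euler (X \<oplus> Y) = euler X \<oplus> euler Y"
  by (intro ext) (simp add: euler_def ser_add_def gam.scale_right_distrib)

lemma commuting_euler: "ser X \<Longrightarrow> commuting X Y \<Longrightarrow> commuting X (euler Y)"
  by (simp add: commuting_def euler_def ser_arg_scal)

lemma euler_pow:
  assumes "ser X" "commuting X X"
  shows "euler (ser_pow X k) e f = scal (of_nat k) ((euler X \<odot> ser_pow X (k - 1)) e f)"
proof (induction k arbitrary: e f)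
  case 0
  show ?case by (simp add: euler_def ser_one_def wt_zero)
next
  case (Suc k)
  let ?P = "ser_pow X" and ?D = "euler X"
  have "(X \<odot> euler (?P k)) e f = (\<Sum>d\<in>splits e. X (e - d) (euler (?P k) d f))"
    using assms(1) by (simp add: mult_eq ser_euler ser_ser_pow)
  also have "\<dots> = (\<Sum>d\<in>splits e. X (e - d) (scal (of_nat k) ((?D \<odot> ?P (k - 1)) d f)))"
    by (simp only: Suc.IH)
  also have "\<dots> = scal (of_nat k) ((X \<odot> (?D \<odot> ?P (k - 1))) e f)"
    using assms(1)
    by (simp add: mult_eq ser_euler ser_ser_pow ser_ser_mult ser_arg_scal ser_arg_sum gam.scale_sum_right)
  also have "X \<odot> (?D \<odot> ?P (k - 1)) = ?D \<odot> (X \<odot> ?P (k - 1))"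
    using assms by (intro mult_left_commute ser_euler ser_ser_pow commuting_euler)
  also have "scal (of_nat k) ((?D \<odot> (X \<odot> ?P (k - 1))) e f) = scal (of_nat k) ((?D \<odot> ?P k) e f)"
    by (cases k) simp_all
  finally show ?case
    using assms(1)
    by (simp add: euler_mult ser_ser_pow ser_add_def gam.scale_left_distrib)
qed

lemma pow_vanish:
  assumes "ser X" "\<And>f. X 0 f = 0" "wt e < int k"
  shows "ser_pow X k e f = 0"
  using assms(3)
proof (induction k arbitrary: e f)
  case 0
  then show ?case by (auto simp: ser_one_def wt_zero)
next
  case (Suc k)
  have "X (e - d) (ser_pow X k d f) = 0" if "d \<in> splits e" for d
  proof (cases "e = d")
    case False
    with that have "wt (e - d) > 0" by (intro wt_pos) (auto simp: splits_def)
    then have "wt d < int k" using Suc.prems by (simp add: wt_diff)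
    then show ?thesis using assms(1) by (simp add: Suc.IH ser_arg_zero)
  qed (simp add: assms(2))
  then show ?case using assms(1) by (simp add: mult_eq ser_ser_pow)
qed

lemma exp_eq:
  assumes "ser X" "\<And>f. X 0 f = 0" "wt e \<le> int n"
  shows "ser_exp X e f = (\<Sum>k\<le>n. scal (1 / fact k) (ser_pow X k e f))"
  unfolding ser_exp_def
proof (rule Sum_any.expand_superset)
  show "{k. scal (1 / fact k) (ser_pow X k e f) \<noteq> 0} \<subseteq> {..n}"
  proof
    fix k assume "k \<in> {k. scal (1 / fact k) (ser_pow X k e f) \<noteq> 0}"
    then have "ser_pow X k e f \<noteq> 0" by auto
    then have "\<not> wt e < int k" using pow_vanish[OF assms(1,2)] by blast
    with assms(3) show "k \<in> {..n}" by simp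
  qed
qed simp

lemma ser_ser_exp:
  assumes "ser X" "\<And>f. X 0 f = 0"
  shows "ser (ser_exp X)"
proof (rule serI)
  fix e
  have "ser_exp X e = (\<lambda>f. \<Sum>k\<le>nat (wt e). scal (1 / fact k) (ser_pow X k e f))"
    by (intro ext exp_eq assms) simp
  moreover have "glin (\<lambda>f. \<Sum>k\<le>nat (wt e). scal (1 / fact k) (ser_pow X k e f))"
    using assms(1) by (intro glin_sum glin_scal ser_glin ser_ser_pow)
  ultimately show "glin (ser_exp X e)" by simp
next
  show "ser_exp X e f = 0" if "e \<notin> C" for e f
  proof -
    have "ser_pow X k e f = 0" for k
      using ser_outside[OF ser_ser_pow[OF assms(1)] that] .
    then have "(\<lambda>k. scal (1 / fact k) (ser_pow X k e f)) = (\<lambda>k. 0)" by simp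
    then show ?thesis unfolding ser_exp_def by (simp only: Sum_any.neutral)
  qed
qed

lemma exp_at_zero:
  assumes "ser X" "\<And>f. X 0 f = 0"
  shows "ser_exp X 0 f = f"
proof -
  have "ser_exp X 0 f = (\<Sum>k\<le>0. scal (1 / fact k) (ser_pow X k 0 f))"
    by (rule exp_eq) (simp_all add: assms wt_zero)
  then show ?thesis by (simp add: ser_one_def)
qed

text \<open>
  The logarithmic derivative of an exponential.  Coefficient by coefficient this is a recursion on
  the weight, and it replaces the exponential series from here on.
\<close>

lemma exp_euler:
  assumes "ser X" "\<And>f. X 0 f = 0" "commuting X X"
  shows "euler (ser_exp X) = euler X \<odot> ser_exp X"
proof (intro ext)
  fix e f
  define n where "n = nat (wt e)"
  let ?P = "ser_pow X" and ?D = "euler X"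
  note [simp] = ser_euler[OF assms(1)] ser_ser_pow[OF assms(1)] ser_ser_exp[OF assms(1,2)]
  have "euler (ser_exp X) e f = (\<Sum>k\<le>Suc n. scal (1 / fact k) (euler (?P k) e f))"
    using exp_eq[OF assms(1,2), of e "Suc n" f]
    by (simp add: n_def euler_def gam.scale_sum_right mult.commute del: sum.atMost_Suc)
  also have "\<dots> = (\<Sum>k\<le>Suc n. scal (of_nat k / fact k) ((?D \<odot> ?P (k - 1)) e f))"
    by (simp add: euler_pow[OF assms(1,3)] del: sum.atMost_Suc)
  also have "\<dots> = (\<Sum>k\<le>n. scal (1 / fact k) ((?D \<odot> ?P k) e f))"
    by (subst sum.atMost_Suc_shift) (simp add: fact_reduce del: of_nat_Suc)
  also have "\<dots> = (\<Sum>d\<in>splits e. \<Sum>k\<le>n. scal (1 / fact k) (?D (e - d) (?P k d f)))"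
    by (simp add: mult_eq gam.scale_sum_right) (rule sum.swap)
  also have "\<dots> = (\<Sum>d\<in>splits e. ?D (e - d) (ser_exp X d f))"
  proof (rule sum.cong[OF refl])
    fix d assume "d \<in> splits e"
    then have "wt d \<le> int n" using wt_nonneg[of "e - d"] by (simp add: splits_def n_def wt_diff)
    then show "(\<Sum>k\<le>n. scal (1 / fact k) (?D (e - d) (?P k d f))) = ?D (e - d) (ser_exp X d f)"
      by (simp add: exp_eq[OF assms(1,2)] ser_arg_sum ser_arg_scal)
  qed
  also have "\<dots> = (?D \<odot> ser_exp X) e f"
    by (simp add: mult_eq)
  finally show "euler (ser_exp X) e f = (?D \<odot> ser_exp X) e f" .
qed

text \<open>
  A coefficient of positive weight is determined by those of smaller weight, because the
  characteristic is zero and \<open>X\<close> has no constant term.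
\<close>

lemma euler_unique:
  assumes "ser X" "\<And>f. X 0 f = 0" "ser G" "ser H"
    and "\<And>f. G 0 f = H 0 f" "euler G = euler X \<odot> G" "euler H = euler X \<odot> H"
  shows "G = H"
proof -
  have "G e f = H e f" if "e \<in> C" for e f
    using that
  proof (induction "nat (wt e)" arbitrary: e rule: less_induct)
    case less
    show ?case
    proof (cases "e = 0")
      case False
      have "(euler X \<odot> G) e f = (euler X \<odot> H) e f"
        using assms(1,3,4)
      proof (simp add: mult_eq ser_euler, intro sum.cong refl)
        fix d assume d: "d \<in> splits e"
        show "euler X (e - d) (G d f) = euler X (e - d) (H d f)"
        proof (cases "e = d")
          case True
          then show ?thesis by (simp add: euler_def wt_zero)
        next
          case False
          with d have "wt (e - d) > 0" by (intro wt_pos) (auto simp: splits_def)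
          then have "nat (wt d) < nat (wt e)"
            using wt_nonneg[of d] d by (simp add: wt_diff splits_def)
          then show ?thesis using less.hyps[of d] d by (simp add: splits_def)
        qed
      qed
      then have "scal (of_int (wt e)) (G e f) = scal (of_int (wt e)) (H e f)"
        using assms(6,7) by (metis euler_def)
      then have "scal (1 / of_int (wt e)) (scal (of_int (wt e)) (G e f)) =
          scal (1 / of_int (wt e)) (scal (of_int (wt e)) (H e f))" by simp
      then show ?thesis using wt_pos[OF less.prems False] by simp
    qed (simp add: assms(5))
  qed
  then show ?thesis using assms(3,4) by (intro ext) (metis ser_outside)
qed

lemma exp_commute:
  assumes "ser X" "\<And>f. X 0 f = 0" "glin T" "\<And>d f. T (X d f) = X d (T f)"
  shows "T (ser_exp X e f) = ser_exp X e (T f)"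
proof -
  have "T (ser_pow X k e f) = ser_pow X k e (T f)" for k e f
  proof (induction k arbitrary: e f)
    case 0
    show ?case using glin_at_zero[OF assms(3)] by (simp add: ser_one_def)
  next
    case (Suc k)
    then show ?case
      using assms by (simp add: mult_eq ser_ser_pow glin_of_sum[OF assms(3)])
  qed
  then show ?thesis
    using exp_eq[OF assms(1,2), of e "nat (wt e)"]
    by (simp add: glin_of_sum[OF assms(3)] glin_scale[OF assms(3)])
qed

lemma exp_add:
  assumes X: "ser X" "\<And>f. X 0 f = 0" "commuting X X"
    and Y: "ser Y" "\<And>f. Y 0 f = 0" "commuting Y Y"
    and XY: "commuting X Y"
  shows "ser_exp (X \<oplus> Y) = ser_exp X \<odot> ser_exp Y"
proof (rule euler_unique)
  note [simp] = X(1) Y(1) ser_ser_exp[OF X(1,2)] ser_ser_exp[OF Y(1,2)]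
    ser_ser_add ser_ser_mult ser_euler
  show "ser (X \<oplus> Y)" "ser (ser_exp X \<odot> ser_exp Y)" by simp_all
  show XY0: "(X \<oplus> Y) 0 f = 0" for f by (simp add: ser_add_def X Y)
  show "ser (ser_exp (X \<oplus> Y))" using XY0 by (intro ser_ser_exp) simp_all
  show "ser_exp (X \<oplus> Y) 0 f = (ser_exp X \<odot> ser_exp Y) 0 f" for f
    by (simp add: exp_at_zero XY0 mult_eq splits_zero X Y)
  have "commuting (X \<oplus> Y) (X \<oplus> Y)"
    using X(3) Y(3) XY by (auto simp: commuting_def ser_add_def ser_arg_add)
  then show "euler (ser_exp (X \<oplus> Y)) = euler (X \<oplus> Y) \<odot> ser_exp (X \<oplus> Y)"
    using XY0 by (intro exp_euler) simp_all
  have "commuting (ser_exp X) Y"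
    using XY exp_commute[OF X(1,2) ser_glin[OF Y(1)]] by (simp add: commuting_def)
  then have "ser_exp X \<odot> (euler Y \<odot> ser_exp Y) = euler Y \<odot> (ser_exp X \<odot> ser_exp Y)"
    by (intro mult_left_commute commuting_euler) simp_all
  then show "euler (ser_exp X \<odot> ser_exp Y) = euler (X \<oplus> Y) \<odot> (ser_exp X \<odot> ser_exp Y)"
    by (simp add: euler_mult exp_euler X Y euler_add mult_add_left mult_assoc)
qed

end

section \<open>Series in one and in two variables\<close>

text \<open>
  Operator series in \<open>z\<close> and \<open>w\<close> have exponents in a product of two cones.
\<close>

lemma cone_product:
  assumes "cone C wt" "cone D wt'"
  shows "cone (C \<times> D) (\<lambda>(c, d). wt c + wt' d)"
proof -
  interpret C: cone C wt by fact
  interpret D: cone D wt' by fact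
  show ?thesis
  proof
    show "finite {d \<in> C \<times> D. e - d \<in> C \<times> D}" for e
    proof (rule finite_subset)
      show "{d \<in> C \<times> D. e - d \<in> C \<times> D} \<subseteq> C.splits (fst e) \<times> D.splits (snd e)"
        by (cases e) (auto simp: C.splits_def D.splits_def)
    qed (simp add: C.finite_splits D.finite_splits)
    show "(case d of (c, d) \<Rightarrow> wt c + wt' d) > 0" if "d \<in> C \<times> D" "d \<noteq> 0" for d
    proof (cases d)
      case (Pair x y)
      then have xy: "x \<in> C" "y \<in> D" "x \<noteq> 0 \<or> y \<noteq> 0"
        using that by (auto simp: zero_prod_def)
      then have "wt x > 0 \<and> wt' y \<ge> 0 \<or> wt x \<ge> 0 \<and> wt' y > 0"
        using C.wt_pos C.wt_nonneg D.wt_pos D.wt_nonneg by blast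
      then show ?thesis using Pair by auto
    qed
    show "a + b \<in> C \<times> D" if "a \<in> C \<times> D" "b \<in> C \<times> D" for a b
      using that by (auto intro: C.add_mem D.add_mem)
    show "0 \<in> C \<times> D" by (simp add: zero_prod_def C.zero_mem D.zero_mem)
    show "(case a + b of (c, d) \<Rightarrow> wt c + wt' d) =
        (case a of (c, d) \<Rightarrow> wt c + wt' d) + (case b of (c, d) \<Rightarrow> wt c + wt' d)" for a b
      by (cases a; cases b) (simp add: C.wt_add D.wt_add)
  qed
qed

text \<open>
  The \<open>A\<close>-series have non-negative exponents and the \<open>B\<close>-series non-positive ones.
\<close>

interpretation pos: cone "{0..} :: int set" "\<lambda>i. i"
proof
  show "finite {d \<in> {0..}. e - d \<in> {0..}}" for e :: int
    by (rule finite_subset[of _ "{0..e}"]) auto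
qed auto

interpretation neg: cone "{..0} :: int set" uminus
proof
  show "finite {d \<in> {..0}. e - d \<in> {..0}}" for e :: int
    by (rule finite_subset[of _ "{e..0}"]) auto
qed auto

interpretation pos2: cone "{0..} \<times> {0..} :: (int \<times> int) set" "\<lambda>(i, j). i + j"
  using cone_product[OF pos.cone_axioms pos.cone_axioms] by simp

interpretation neg2: cone "{..0} \<times> {..0} :: (int \<times> int) set" "\<lambda>(i, j). - i + - j"
  using cone_product[OF neg.cone_axioms neg.cone_axioms] by simp

lemma Sum_any_slice_fst:
  "Sum_any (\<lambda>(x, y). if y = b then h x else 0) = Sum_any h"
proof -
  have "{p. (case p of (x, y) \<Rightarrow> if y = b then h x else 0) \<noteq> 0} = (\<lambda>x. (x, b)) ` {x. h x \<noteq> 0}"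
    by (auto split: if_splits)
  then show ?thesis
    by (simp add: Sum_any.expand_set sum.reindex inj_on_def)
qed

lemma Sum_any_slice_snd:
  "Sum_any (\<lambda>(x, y). if x = a then h y else 0) = Sum_any h"
proof -
  have "{p. (case p of (x, y) \<Rightarrow> if x = a then h y else 0) \<noteq> 0} = Pair a ` {y. h y \<noteq> 0}"
    by (auto split: if_splits)
  then show ?thesis
    by (simp add: Sum_any.expand_set sum.reindex inj_on_def)
qed

lemma in_z_mult:
  assumes "\<And>d. X d 0 = 0"
  shows "in_z X \<odot> in_z Y = in_z (X \<odot> Y)"
proof (intro ext)
  fix e :: "int \<times> int" and f
  obtain i j where e: "e = (i, j)" by fastforce
  have "(in_z X \<odot> in_z Y) e f =
      Sum_any (\<lambda>(x, y :: int). if y = 0 then if j = 0 then X (i - x) (Y x f) else 0 else 0)"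
    unfolding ser_mult_def by (rule Sum_any.cong) (auto simp: in_z_def e assms)
  also have "\<dots> = in_z (X \<odot> Y) e f"
    unfolding Sum_any_slice_fst by (simp add: in_z_def e ser_mult_def)
  finally show "(in_z X \<odot> in_z Y) e f = in_z (X \<odot> Y) e f" .
qed

lemma in_w_mult:
  assumes "\<And>d. X d 0 = 0"
  shows "in_w X \<odot> in_w Y = in_w (X \<odot> Y)"
proof (intro ext)
  fix e :: "int \<times> int" and f
  obtain i j where e: "e = (i, j)" by fastforce
  have "(in_w X \<odot> in_w Y) e f =
      Sum_any (\<lambda>(x :: int, y). if x = 0 then if i = 0 then X (j - y) (Y y f) else 0 else 0)"
    unfolding ser_mult_def by (rule Sum_any.cong) (auto simp: in_w_def e assms)
  also have "\<dots> = in_w (X \<odot> Y) e f"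
    unfolding Sum_any_slice_snd by (simp add: in_w_def e ser_mult_def)
  finally show "(in_w X \<odot> in_w Y) e f = in_w (X \<odot> Y) e f" .
qed

lemma in_z_in_w_mult:
  assumes "\<And>d. X d 0 = 0"
  shows "(in_z X \<odot> in_w Y) (i, j) f = X i (Y j f)"
proof -
  have "(in_z X \<odot> in_w Y) (i, j) f = Sum_any (\<lambda>d. if d = (0 :: int, j) then X i (Y j f) else 0)"
    unfolding ser_mult_def by (rule Sum_any.cong) (auto simp: in_z_def in_w_def assms split: if_splits)
  then show ?thesis by simp
qed

lemma in_z_exp:
  assumes "\<And>d. X d 0 = 0"
  shows "ser_exp (in_z X) = in_z (ser_exp X)"
proof -
  have pow: "ser_pow (in_z X) k = in_z (ser_pow X k)" for k
  proof (induction k)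
    case 0
    show ?case by (intro ext) (auto simp: in_z_def ser_one_def zero_prod_def split: if_splits)
  qed (simp add: in_z_mult assms)
  show ?thesis
    unfolding ser_exp_def[abs_def] pow by (intro ext) (auto simp: in_z_def)
qed

lemma in_w_exp:
  assumes "\<And>d. X d 0 = 0"
  shows "ser_exp (in_w X) = in_w (ser_exp X)"
proof -
  have pow: "ser_pow (in_w X) k = in_w (ser_pow X k)" for k
  proof (induction k)
    case 0
    show ?case by (intro ext) (auto simp: in_w_def ser_one_def zero_prod_def split: if_splits)
  qed (simp add: in_w_mult assms)
  show ?thesis
    unfolding ser_exp_def[abs_def] pow by (intro ext) (auto simp: in_w_def)
qed

section \<open>Exchanging exponentials of creation and annihilation operators\<close>

lemma sum_triangle_diagonal:
  fixes g :: "nat \<Rightarrow> nat \<Rightarrow> 'a::comm_monoid_add"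
  shows "(\<Sum>k\<le>a. \<Sum>m\<le>a - k. g k m) = (\<Sum>l\<le>a. \<Sum>k\<le>l. g k (l - k))"
  unfolding sum.Sigma[OF finite_atMost ballI[OF finite_atMost]]
  by (rule sum.reindex_bij_witness[of _ "\<lambda>(l, k). (k, l - k)" "\<lambda>(k, m). (k + m, k)"]) auto

lemma sum_triangle_swap:
  fixes g :: "nat \<Rightarrow> nat \<Rightarrow> 'a::comm_monoid_add"
  shows "(\<Sum>k\<le>a. \<Sum>m\<le>a - k. g k m) = (\<Sum>m\<le>a. \<Sum>k\<le>a - m. g k m)"
  unfolding sum.Sigma[OF finite_atMost ballI[OF finite_atMost]]
  by (rule sum.reindex_bij_witness[of _ "\<lambda>(m, k). (k, m)" "\<lambda>(k, m). (m, k)"]) auto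

lemma scal_cancel: "c \<noteq> 0 \<Longrightarrow> scal c f = scal c g \<Longrightarrow> f = g"
  by (metis gam.scale_one gam.scale_scale left_inverse)

text \<open>
  Moving one annihilation operator through an exponential of creation operators: if
  \<open>[B, A\<^sub>k] = c \<delta>\<^sub>k\<^sub>m\<close>, then \<open>[B, E\<^sub>n] = c E\<^bsub>n-m\<^esub>\<close>, where \<open>E\<^sub>n\<close> are the coefficients of
  \<open>exp (\<Sum>\<^sub>k A\<^sub>k w\<^sup>k)\<close>.  Only the recursion \<open>n E\<^sub>n = \<Sum>\<^sub>k k A\<^sub>k E\<^bsub>n-k\<^esub>\<close> is used; as
  \<open>E\<^bsub>n-k\<^esub> = 0\<close> for \<open>k > n\<close>, any bound \<open>N \<ge> n\<close> may be taken for the sum.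
\<close>

lemma annihilator_exp:
  fixes A :: "nat \<Rightarrow> Gam \<Rightarrow> Gam" and E :: "int \<Rightarrow> Gam \<Rightarrow> Gam"
  assumes A: "\<And>k. glin (A k)" and B: "glin B" and m: "m > 0"
    and E0: "\<And>f. E 0 f = f" and Eneg: "\<And>n f. n < 0 \<Longrightarrow> E n f = 0"
    and recE: "\<And>n N f. n \<le> int N \<Longrightarrow>
      scal (of_int n) (E n f) = (\<Sum>k\<le>N. scal (of_nat k) (A k (E (n - int k) f)))"
    and BA: "\<And>k f. B (A k f) = A k (B f) + (if k = m then scal c f else 0)"
  shows "B (E n f) = E n (B f) + scal c (E (n - int m) f)"
proof (induction "nat n" arbitrary: n rule: less_induct)
  case less
  consider "n < 0" | "n = 0" | "n > 0" by linarith
  then show ?case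
  proof cases
    case 1
    then show ?thesis using m by (simp add: Eneg glin_at_zero[OF B])
  next
    case 2
    then show ?thesis using m by (simp add: E0 Eneg)
  next
    case 3
    \<comment> \<open>The bound is at least \<open>m\<close>, so the summand \<open>k = m\<close> is present even when \<open>m > n\<close>.\<close>
    define N where "N = nat n + m"
    have step: "scal (of_nat k) (A k (B (E (n - int k) f))) =
        scal (of_nat k) (A k (E (n - int k) (B f))) +
        scal c (scal (of_nat k) (A k (E (n - int m - int k) f)))" for k
    proof (cases "k = 0")
      case False
      then have "B (E (n - int k) f) = E (n - int k) (B f) + scal c (E (n - int k - int m) f)"
        using 3 by (intro less.hyps) simp
      then show ?thesis
        by (simp add: glin_plus[OF A] glin_scale[OF A] gam.scale_right_distrib algebra_simps)
    qed simp
    have "scal (of_int n) (B (E n f)) = B (\<Sum>k\<le>N. scal (of_nat k) (A k (E (n - int k) f)))"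
      by (simp add: recE[symmetric] N_def flip: glin_scale[OF B])
    also have "\<dots> = (\<Sum>k\<le>N. scal (of_nat k) (A k (B (E (n - int k) f)))) +
        (\<Sum>k\<le>N. if k = m then scal (of_nat k) (scal c (E (n - int k) f)) else 0)"
      unfolding sum.distrib[symmetric]
      by (simp add: glin_of_sum[OF B] glin_scale[OF B] BA gam.scale_right_distrib)
        (intro sum.cong, auto)
    also have "(\<Sum>k\<le>N. if k = m then scal (of_nat k) (scal c (E (n - int k) f)) else 0) =
        scal (of_nat m * c) (E (n - int m) f)"
      by (simp add: N_def)
    also have "(\<Sum>k\<le>N. scal (of_nat k) (A k (B (E (n - int k) f)))) =
        scal (of_int n) (E n (B f)) + scal c (scal (of_int (n - int m)) (E (n - int m) f))"
      unfolding step sum.distrib gam.scale_sum_right[symmetric]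
      by (simp add: recE[symmetric] N_def del: of_int_diff)
    also have "\<dots> + scal (of_nat m * c) (E (n - int m) f) =
        scal (of_int n) (E n (B f) + scal c (E (n - int m) f))"
      by (simp add: gam.scale_right_distrib algebra_simps flip: gam.scale_left_distrib)
    finally show ?thesis
      by (rule scal_cancel[rotated]) (use 3 in simp)
  qed
qed

text \<open>
  Exchanging two exponentials, coefficientwise.  If \<open>D\<^sub>a\<close> and \<open>E\<^sub>b\<close> are the coefficients of
  \<open>exp (\<Sum>\<^sub>k B\<^sub>k v\<^sup>k)\<close> and \<open>exp (\<Sum>\<^sub>k A\<^sub>k w\<^sup>k)\<close>, and \<open>F = exp (\<Sum>\<^sub>k c\<^sub>k u\<^sup>k)\<close> with
  \<open>[B\<^sub>m, E\<^sub>n] = c\<^sub>m E\<^bsub>n-m\<^esub>\<close>, then \<open>D(v) E(w) = F(vw) E(w) D(v)\<close>.  The proof is by induction on \<open>a\<close>, from the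
  recursion for \<open>a D\<^sub>a\<close>: the two kinds of summands contribute the multiples \<open>a - m\<close> and \<open>m\<close> of
  \<open>F\<^sub>m E\<^bsub>b-m\<^esub> D\<^bsub>a-m\<^esub>\<close>.
\<close>

lemma exp_exchange:
  fixes B D :: "nat \<Rightarrow> Gam \<Rightarrow> Gam" and E :: "int \<Rightarrow> Gam \<Rightarrow> Gam" and F c :: "nat \<Rightarrow> Qt"
  assumes E: "\<And>n. glin (E n)" and B: "\<And>m. glin (B m)"
    and D0: "\<And>f. D 0 f = f"
    and recD: "\<And>a f. scal (of_nat a) (D a f) = (\<Sum>k\<le>a. scal (of_nat k) (B k (D (a - k) f)))"
    and F0: "F 0 = 1"
    and recF: "\<And>n. of_nat n * F n = (\<Sum>k\<le>n. of_nat k * c k * F (n - k))"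
    and BE: "\<And>m n f. m > 0 \<Longrightarrow> B m (E n f) = E n (B m f) + scal (c m) (E (n - int m) f)"
  shows "D a (E b f) = (\<Sum>m\<le>a. scal (F m) (E (b - int m) (D (a - m) f)))"
proof (induction a arbitrary: b f rule: less_induct)
  case (less a)
  show ?case
  proof (cases "a = 0")
    case True
    then show ?thesis by (simp add: D0 F0)
  next
    case False
    let ?T = "\<lambda>l. E (b - int l) (D (a - l) f)"
    have summand: "scal (of_nat k) (B k (D (a - k) (E b f))) =
        (\<Sum>m\<le>a - k. scal (F m) (E (b - int m) (scal (of_nat k) (B k (D (a - m - k) f))))) +
        (\<Sum>m\<le>a - k. scal (of_nat k * c k * F m) (?T (k + m)))" for k
    proof (cases "k = 0")
      case True
      then show ?thesis by (simp add: glin_at_zero[OF E])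
    next
      case k: False
      have "D (a - k) (E b f) = (\<Sum>m\<le>a - k. scal (F m) (E (b - int m) (D (a - k - m) f)))"
        using k False by (intro less.IH) simp
      then show ?thesis
        using k
        by (simp add: glin_of_sum[OF B] glin_scale[OF B] glin_scale[OF E] BE gam.scale_sum_right
            gam.scale_right_distrib sum.distrib algebra_simps)
    qed
    have "scal (of_nat a) (D a (E b f)) = (\<Sum>k\<le>a. scal (of_nat k) (B k (D (a - k) (E b f))))"
      by (rule recD)
    also have "\<dots> =
        (\<Sum>k\<le>a. \<Sum>m\<le>a - k. scal (F m) (E (b - int m) (scal (of_nat k) (B k (D (a - m - k) f))))) +
        (\<Sum>k\<le>a. \<Sum>m\<le>a - k. scal (of_nat k * c k * F m) (?T (k + m)))"
      unfolding summand sum.distrib ..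
    also have "(\<Sum>k\<le>a. \<Sum>m\<le>a - k.
          scal (F m) (E (b - int m) (scal (of_nat k) (B k (D (a - m - k) f))))) =
        (\<Sum>m\<le>a. scal (F m) (E (b - int m) (\<Sum>k\<le>a - m. scal (of_nat k) (B k (D (a - m - k) f)))))"
      by (subst sum_triangle_swap) (simp add: glin_of_sum[OF E] gam.scale_sum_right)
    also have "\<dots> = (\<Sum>m\<le>a. scal (of_nat (a - m) * F m) (?T m))"
      unfolding recD[symmetric] by (simp add: glin_scale[OF E] mult.commute del: of_nat_diff)
    also have "(\<Sum>k\<le>a. \<Sum>m\<le>a - k. scal (of_nat k * c k * F m) (?T (k + m))) =
        (\<Sum>l\<le>a. scal (of_nat l * F l) (?T l))"
      by (subst sum_triangle_diagonal) (simp add: recF gam.scale_sum_left)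
    also have "(\<Sum>m\<le>a. scal (of_nat (a - m) * F m) (?T m)) + (\<Sum>l\<le>a. scal (of_nat l * F l) (?T l)) =
        (\<Sum>m\<le>a. scal (of_nat a * F m) (?T m))"
      unfolding sum.distrib[symmetric]
      by (intro sum.cong refl)
        (simp add: of_nat_diff algebra_simps flip: gam.scale_left_distrib)
    also have "\<dots> = scal (of_nat a) (\<Sum>m\<le>a. scal (F m) (?T m))"
      by (simp add: gam.scale_sum_right)
    finally show ?thesis
      by (rule scal_cancel[rotated]) (use False in simp)
  qed
qed

section \<open>The scalar factor as a formal power series\<close>

lemma F_ser_nth_0: "fps_nth (F_ser t s) 0 = 1"
  by (simp add: F_ser_def fps_compose_nth_0)

text \<open>
  The formal logarithm of \<open>F\<^bsub>t,s\<^esub>\<close>.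
\<close>

definition F_log :: "Qt \<Rightarrow> Qt \<Rightarrow> Qt fps" where
  "F_log t s =
     fps_const (- 2) * Abs_fps (\<lambda>n. if odd n then (1 - s ^ n) / (1 - t ^ n) / of_nat n else 0)"

lemma fps_deriv_F_ser: "fps_deriv (F_ser t s) = fps_deriv (F_log t s) * F_ser t s"
proof -
  have "F_ser t s = fps_exp 1 oo F_log t s" by (simp add: F_ser_def F_log_def)
  moreover have "fps_nth (F_log t s) 0 = 0" by (simp add: F_log_def)
  ultimately show ?thesis by (simp add: fps_compose_deriv)
qed

lemma fps_deriv_eq_mult_nth:
  fixes G W :: "'a::comm_ring_1 fps"
  assumes "fps_deriv G = fps_deriv W * G"
  shows "of_nat n * fps_nth G n = (\<Sum>k\<le>n. of_nat k * fps_nth W k * fps_nth G (n - k))"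
proof (cases n)
  case (Suc n')
  have "fps_nth (fps_deriv G) n' = (\<Sum>i\<le>n'. of_nat (Suc i) * fps_nth W (Suc i) * fps_nth G (n' - i))"
    unfolding assms by (simp add: fps_mult_nth atMost_atLeast0)
  then show ?thesis unfolding Suc by (subst sum.atMost_Suc_shift) simp
qed simp

lemma fps_linear_ode_unique:
  fixes G H W :: "'a::field_char_0 fps"
  assumes "fps_deriv G = W * G" "fps_deriv H = W * H" "fps_nth G 0 = fps_nth H 0"
  shows "G = H"
proof (rule fps_ext)
  fix n
  show "fps_nth G n = fps_nth H n"
  proof (induction n rule: less_induct)
    case (less n)
    show ?case
    proof (cases n)
      case (Suc n')
      have "fps_nth (W * G) n' = fps_nth (W * H) n'"
        unfolding fps_mult_nth by (intro sum.cong refl) (simp add: less.IH Suc)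
      then have "fps_nth (fps_deriv G) n' = fps_nth (fps_deriv H) n'" by (simp add: assms(1,2))
      then show ?thesis unfolding Suc by (simp del: of_nat_Suc)
    qed (simp add: assms(3))
  qed
qed

lemma indet_power_neq_1: "n > 0 \<Longrightarrow> indet ^ n \<noteq> 1"
proof
  assume "n > 0" "indet ^ n = 1"
  have "to_fract p ^ n = to_fract (p ^ n)" for p :: "rat poly"
    by (induction n) simp_all
  then have "indet ^ n = to_fract (monom 1 n)"
    by (simp add: indet_def monom_altdef)
  with \<open>indet ^ n = 1\<close> have "to_fract (monom 1 n :: rat poly) = to_fract 1" by simp
  then have "monom 1 n = (1 :: rat poly)" by (simp only: to_fract_eq_iff)
  with \<open>n > 0\<close> show False by (metis degree_1 degree_monom_eq less_irrefl one_neq_zero)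
qed

text \<open>
  The logarithmic derivative \<open>-2c / (1 - c\<^sup>2 u\<^sup>2)\<close> of \<open>(1 - c u) / (1 + c u)\<close>.
\<close>

lemma fps_deriv_moebius:
  fixes c :: "'a::field"
  defines "R \<equiv> (1 - fps_const c * fps_X) / (1 + fps_const c * fps_X)"
  shows "fps_deriv R = Abs_fps (\<lambda>n. if even n then - 2 * c ^ Suc n else 0) * R"
proof -
  define a b V where "a = 1 - fps_const c * fps_X" and "b = 1 + fps_const c * fps_X"
    and "V = Abs_fps (\<lambda>n. if even n then - 2 * c ^ Suc n else 0)"
  have b0: "fps_nth b 0 \<noteq> 0" by (simp add: b_def)
  then have bnz: "b \<noteq> 0" by auto
  have Rb: "R * b = a"
    using b0 by (simp add: R_def fps_divide_unit flip: a_def b_def) 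
      (simp add: mult.assoc inverse_mult_eq_1)
  have "fps_deriv (R * b) = - fps_const c"
    unfolding Rb by (simp add: a_def)
  then have "fps_deriv R * b = - fps_const c - R * fps_const c"
    by (simp add: b_def algebra_simps)
  then have "fps_deriv R * b * b = (- fps_const c - R * fps_const c) * b"
    by (simp only:)
  also have "\<dots> = - fps_const c * b - fps_const c * (R * b)"
    by (simp add: algebra_simps)
  also have "\<dots> = fps_const (- 2 * c)"
    unfolding Rb by (simp add: a_def b_def algebra_simps flip: fps_const_add) 
  also have "\<dots> = V * (1 - fps_const (c ^ 2) * fps_X ^ 2)"
  proof (rule fps_ext)
    fix n
    have "V * (1 - fps_const (c ^ 2) * fps_X ^ 2) = V - fps_const (c ^ 2) * (V * fps_X ^ 2)"
      by (simp add: right_diff_distrib mult.left_commute)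
    then have nth: "fps_nth (V * (1 - fps_const (c ^ 2) * fps_X ^ 2)) n =
        fps_nth V n - c ^ 2 * (if n < 2 then 0 else fps_nth V (n - 2))"
      by (simp add: fps_X_power_mult_right_nth)
    show "fps_nth (fps_const (- 2 * c)) n = fps_nth (V * (1 - fps_const (c ^ 2) * fps_X ^ 2)) n"
    proof (cases "n < 2")
      case True
      then have "n = 0 \<or> n = 1" by auto
      then show ?thesis unfolding nth by (auto simp: V_def)
    next
      case False
      then obtain k where "n = k + 2" by (metis add.commute le_add_diff_inverse not_less)
      then show ?thesis unfolding nth by (simp add: V_def power_add power2_eq_square)
    qed
  qed
  also have "1 - fps_const (c ^ 2) * fps_X ^ 2 = a * b"
  proof -
    have "1 - (u * u) * (x * x) = (1 - u * x) * (1 + u * x)" for u x :: "'a fps"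
      by (simp add: algebra_simps)
    moreover have "fps_const (c ^ 2) = fps_const c * fps_const c" by (simp add: power2_eq_square)
    ultimately show ?thesis
      unfolding a_def b_def by (simp only: power2_eq_square)
  qed
  also have "V * (a * b) = V * R * b * b"
    unfolding Rb[symmetric] by (simp add: algebra_simps)
  finally have "fps_deriv R = V * R" using bnz by simp
  then show ?thesis by (simp add: V_def)
qed

text \<open>
  Both sides satisfy the same linear differential equation: the finite geometric sum
  \<open>(1 - t\<^bsup>Mn\<^esup>) / (1 - t\<^sup>n) = \<Sum>\<^bsub>j<M\<^esub> t\<^bsup>jn\<^esup>\<close> splits the logarithm of \<open>F\<close> into those of the \<open>M\<close> factors.
\<close>

lemma F_ser_indet:
  "F_ser indet (indet ^ M) =
     (\<Prod>j<M. (1 - fps_const (indet ^ j) * fps_X) / (1 + fps_const (indet ^ j) * fps_X))"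
proof (rule fps_linear_ode_unique)
  define R :: "nat \<Rightarrow> Qt fps" where
    "R = (\<lambda>j. (1 - fps_const (indet ^ j) * fps_X) / (1 + fps_const (indet ^ j) * fps_X))"
  define V :: "nat \<Rightarrow> Qt fps" where
    "V = (\<lambda>j. Abs_fps (\<lambda>n. if even n then - 2 * (indet ^ j) ^ Suc n else 0))"
  have V: "fps_deriv (R j) = V j * R j" for j
    unfolding R_def V_def by (rule fps_deriv_moebius)
  have "fps_deriv (\<Prod>j<M. R j) = (\<Sum>j<M. V j) * (\<Prod>j<M. R j)"
    by (induction M) (simp_all add: V algebra_simps)
  also have "(\<Sum>j<M. V j) = fps_deriv (F_log indet (indet ^ M))"
  proof (rule fps_ext)
    fix n
    have t: "indet ^ Suc n \<noteq> 1" by (rule indet_power_neq_1) simp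
    have "(\<Sum>j<M. (indet ^ j) ^ Suc n) = (\<Sum>j<M. (indet ^ Suc n) ^ j)"
      by (simp only: power_mult[symmetric] mult.commute)
    also have "\<dots> = (1 - (indet ^ M) ^ Suc n) / (1 - indet ^ Suc n)"
      by (subst sum_gp_strict) (simp add: t del: power_Suc, simp only: power_mult[symmetric] mult.commute)
    finally have geom: "(\<Sum>j<M. (indet ^ j) ^ Suc n) = (1 - (indet ^ M) ^ Suc n) / (1 - indet ^ Suc n)" .
    have "fps_nth (\<Sum>j<M. V j) n = (if even n then - 2 * (\<Sum>j<M. (indet ^ j) ^ Suc n) else 0)"
      by (simp add: V_def fps_sum_nth sum_distrib_left del: power_Suc)
    also have "\<dots> = fps_nth (fps_deriv (F_log indet (indet ^ M))) n"
      unfolding geom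
      by (simp add: F_log_def minus_divide_left del: power_Suc of_nat_Suc divide_minus_left)
    finally show "fps_nth (\<Sum>j<M. V j) n = fps_nth (fps_deriv (F_log indet (indet ^ M))) n" .
  qed
  finally show "fps_deriv (\<Prod>j<M. (1 - fps_const (indet ^ j) * fps_X) / (1 + fps_const (indet ^ j) * fps_X)) =
      fps_deriv (F_log indet (indet ^ M)) *
      (\<Prod>j<M. (1 - fps_const (indet ^ j) * fps_X) / (1 + fps_const (indet ^ j) * fps_X))"
    unfolding R_def .
next
  have "fps_nth ((1 - fps_const (indet ^ j) * fps_X) / (1 + fps_const (indet ^ j) * fps_X)) 0 = 1"
    for j by (simp add: fps_divide_unit)
  then have "fps_nth (\<Prod>j<M. (1 - fps_const (indet ^ j) * fps_X) / (1 + fps_const (indet ^ j) * fps_X)) 0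
      = 1"
    by (induction M) simp_all
  then show "fps_nth (F_ser indet (indet ^ M)) 0 = fps_nth
      (\<Prod>j<M. (1 - fps_const (indet ^ j) * fps_X) / (1 + fps_const (indet ^ j) * fps_X)) 0"
    by (simp add: F_ser_nth_0)
qed (rule fps_deriv_F_ser)

lemma prod_fps_divide:
  fixes f g :: "'b \<Rightarrow> 'a::field fps"
  assumes "\<And>j. j \<in> S \<Longrightarrow> fps_nth (g j) 0 \<noteq> 0"
  shows "(\<Prod>j\<in>S. f j / g j) = (\<Prod>j\<in>S. f j) / (\<Prod>j\<in>S. g j)"
  using assms
proof (induction S rule: infinite_finite_induct)
  case (insert x S)
  have nz: "fps_nth (\<Prod>j\<in>S. g j) 0 \<noteq> 0"
    using insert.hyps(1) insert.prems by (induction S rule: finite_induct) auto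
  with insert show ?case
    by (simp add: fps_divide_unit fps_inverse_mult)
qed simp_all

lemma prod_eq_qpoch_quotient:
  fixes q :: "'a::field"
  shows "(\<Prod>j<M. (1 - fps_const (q ^ j) * fps_X) / (1 + fps_const (q ^ j) * fps_X)) =
      qpoch fps_X (fps_const q) M / qpoch (- fps_X) (fps_const q) M"
  unfolding qpoch_def
  by (subst prod_fps_divide) (simp_all add: fps_const_power mult.commute)

section \<open>The vertex operators\<close>

lemma A_ser_eq:
  "A_ser s i f = (if i > 0 \<and> odd i
     then scal (2 * (1 - s ^ nat i) / of_int i) (pvar (nat i) * f) else 0)"
  by (simp add: A_ser_def a_op_def)

lemma B_ser_eq:
  "B_ser s i f = (if i < 0 \<and> odd i
     then scal (1 / (s ^ nat (- i) - 1)) (dp (nat (- i)) f) else 0)"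
proof -
  have "- (2 / (n * (1 - x))) * (n / 2) = 1 / (x - 1)" if "n \<noteq> 0" for n x :: Qt
  proof (cases "x = 1")
    case False
    then have "1 - x \<noteq> 0" "x - 1 \<noteq> 0" by simp_all
    with that show ?thesis by (simp add: field_simps)
  qed simp
  from this[of "of_int (- i)" "s ^ nat (- i)"] show ?thesis
    unfolding B_ser_def a_op_def Let_def by (auto simp only: gam.scale_scale split: if_splits) auto
qed

lemma glin_A_ser: "glin (A_ser s i)"
  unfolding A_ser_eq[abs_def] by (intro glin_if glin_scal glin_mult)

lemma glin_B_ser: "glin (B_ser s i)"
  unfolding B_ser_eq[abs_def] by (intro glin_if glin_scal[OF glin_dp])

lemma ser_A: "pos.ser (A_ser s)"
  by (rule pos.serI) (simp_all add: glin_A_ser, simp add: A_ser_def)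

lemma ser_B: "neg.ser (B_ser s)"
  by (rule neg.serI) (simp_all add: glin_B_ser, simp add: B_ser_def)

lemma A_ser_0 [simp]: "A_ser s 0 f = 0"
  by (simp add: A_ser_def)

lemma B_ser_0 [simp]: "B_ser s 0 f = 0"
  by (simp add: B_ser_def)

lemma scal_mult_right: "p * scal c f = scal c (p * f)"
  by (simp add: scal_def mult.left_commute)

lemma commuting_A: "commuting (A_ser s) (A_ser s')"
  by (simp add: commuting_def A_ser_eq scal_mult_right mult.left_commute mult.commute)

lemma commuting_B: "commuting (B_ser s) (B_ser s')"
  by (simp add: commuting_def B_ser_eq glin_scale[OF glin_dp] glin_at_zero[OF glin_dp]
      dp_commute mult.commute)

text \<open>
  The coefficients of \<open>B\<^sub>t\<close> and \<open>A\<^sub>s\<close> commute up to the coefficients of \<open>log F\<^bsub>t,s\<^esub>\<close>.  No condition on \<open>t\<close> is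
  needed: where \<open>t\<^sup>m = 1\<close>, every term has the factor \<open>1 / 0 = 0\<close>.
\<close>

lemma heisenberg_B_A:
  assumes "m > 0"
  shows "B_ser t (- int m) (A_ser s (int k) f) =
    A_ser s (int k) (B_ser t (- int m) f) + (if k = m then scal (fps_nth (F_log t s) m) f else 0)"
proof (cases "odd m")
  case False
  then show ?thesis
    using glin_at_zero[OF glin_A_ser] by (simp add: B_ser_def F_log_def)
next
  case m: True
  show ?thesis
  proof (cases "odd k")
    case False
    with m show ?thesis
      using glin_at_zero[OF glin_B_ser] by (auto simp: A_ser_def)
  next
    case k: True
    have "1 / (y - 1) * (2 * (1 - x) / n) = - 2 * ((1 - x) / (1 - y) / n)"
      if "n \<noteq> 0" for n x y :: Qt
    proof (cases "y = 1")
      case False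
      then have "1 - y \<noteq> 0" "y - 1 \<noteq> 0" by simp_all
      with that show ?thesis by (simp add: field_simps)
    qed simp
    then have coeff: "1 / (t ^ m - 1) * (2 * (1 - s ^ m) / of_nat m) = fps_nth (F_log t s) m"
      using m assms by (simp add: F_log_def)
    define \<alpha> \<beta> where "\<alpha> = 2 * (1 - s ^ k) / of_nat k" and "\<beta> = 1 / (t ^ m - 1)"
    have A: "A_ser s (int k) g = scal \<alpha> (pvar k * g)"
      and B: "B_ser t (- int m) g = scal \<beta> (dp m g)" for g
      using m k assms odd_pos[OF k] by (simp_all add: A_ser_eq B_ser_eq \<alpha>_def \<beta>_def)
    have "\<beta> * \<alpha> = fps_nth (F_log t s) m" if "k = m"
      unfolding \<alpha>_def \<beta>_def that by (rule coeff)
    then show ?thesis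
      using m k
      by (simp add: A B glin_scale[OF glin_dp] dp_pvar_mult scal_mult_right
          gam.scale_right_distrib mult.commute[of \<alpha> \<beta>])
  qed
qed

text \<open>
  The coefficients of \<open>e\<^bsup>A\<^sub>s(z)\<^esup>\<close> and \<open>e\<^bsup>B\<^sub>s(z)\<^esup>\<close>.
\<close>

abbreviation EA :: "Qt \<Rightarrow> int opser" where "EA s \<equiv> ser_exp (A_ser s)"
abbreviation EB :: "Qt \<Rightarrow> int opser" where "EB s \<equiv> ser_exp (B_ser s)"

lemma ser_EA: "pos.ser (EA s)"
  by (intro pos.ser_ser_exp ser_A) simp

lemma ser_EB: "neg.ser (EB s)"
  by (intro neg.ser_ser_exp ser_B) simp

lemma glin_EA: "glin (EA s n)"
  by (rule pos.ser_glin[OF ser_EA])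

lemma glin_EB: "glin (EB s n)"
  by (rule neg.ser_glin[OF ser_EB])

lemma EA_negative: "n < 0 \<Longrightarrow> EA s n f = 0"
  by (rule pos.ser_outside[OF ser_EA]) simp

lemma EB_positive: "n > 0 \<Longrightarrow> EB s n f = 0"
  by (rule neg.ser_outside[OF ser_EB]) simp

lemma EA_0: "EA s 0 f = f"
  by (intro pos.exp_at_zero ser_A) simp

lemma EB_0: "EB s 0 f = f"
  by (intro neg.exp_at_zero ser_B) simp

lemma EA_recursion:
  assumes "n \<le> int N"
  shows "scal (of_int n) (EA s n f) =
    (\<Sum>k\<le>N. scal (of_nat k) (A_ser s (int k) (EA s (n - int k) f)))"
proof -
  have "scal (of_int n) (EA s n f) = pos.euler (EA s) n f"
    by (simp add: pos.euler_def)
  also have "\<dots> = (pos.euler (A_ser s) \<odot> EA s) n f"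
    by (subst pos.exp_euler[OF ser_A _ commuting_A]) simp_all
  also have "\<dots> = (\<Sum>d\<in>pos.splits n. scal (of_int (n - d)) (A_ser s (n - d) (EA s d f)))"
    unfolding pos.mult_eq[OF pos.ser_euler[OF ser_A] ser_EA] pos.euler_def ..
  also have "\<dots> = (\<Sum>k\<le>N. scal (of_nat k) (A_ser s (int k) (EA s (n - int k) f)))"
    by (rule sum.reindex_bij_witness_not_neutral[where S' = "{}" and T' = "{k \<in> {..N}. n < int k}"
          and j = "\<lambda>d. nat (n - d)" and i = "\<lambda>k. n - int k"])
      (use assms in \<open>auto simp: pos.splits_def EA_negative glin_at_zero[OF glin_A_ser]\<close>)
  finally show ?thesis .
qed

lemma EB_recursion:
  "scal (of_nat a) (EB s (- int a) f) =
    (\<Sum>k\<le>a. scal (of_nat k) (B_ser s (- int k) (EB s (- int (a - k)) f)))"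
proof -
  have "scal (of_nat a) (EB s (- int a) f) = neg.euler (EB s) (- int a) f"
    by (simp add: neg.euler_def)
  also have "\<dots> = (neg.euler (B_ser s) \<odot> EB s) (- int a) f"
    by (subst neg.exp_euler[OF ser_B _ commuting_B]) simp_all
  also have "\<dots> = (\<Sum>d\<in>neg.splits (- int a).
      scal (of_int (- (- int a - d))) (B_ser s (- int a - d) (EB s d f)))"
    unfolding neg.mult_eq[OF neg.ser_euler[OF ser_B] ser_EB] neg.euler_def ..
  also have "\<dots> = (\<Sum>k\<le>a. scal (of_nat k) (B_ser s (- int k) (EB s (- int (a - k)) f)))"
    by (rule sum.reindex_bij_witness[where
          j = "\<lambda>d. nat (int a + d)" and i = "\<lambda>k. - int (a - k)"])
      (auto simp: neg.splits_def of_nat_diff nat_diff_distrib add.commute[of "of_nat a :: Qt"])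
  finally show ?thesis .
qed

lemma deg_le_B_ser:
  assumes "f \<in> deg_le K"
  shows "B_ser s i f \<in> deg_le (K + i)"
proof (cases "i < 0 \<and> odd i")
  case True
  then have "odd (nat (- i))" by (metis even_minus even_nat_iff less_imp_le neg_0_le_iff_le)
  then have "dp (nat (- i)) f \<in> deg_le (K - int (nat (- i)))"
    using assms by (rule deg_le_dp)
  then show ?thesis using True by (auto simp: B_ser_eq intro: deg_le_scal)
qed (auto simp: B_ser_eq)

lemma deg_le_EB:
  assumes "f \<in> deg_le K"
  shows "EB s i f \<in> deg_le (K + i)"
proof -
  have "ser_pow (B_ser s) k i f \<in> deg_le (K + i)" for k i
  proof (induction k arbitrary: i)
    case 0
    show ?case using assms by (simp add: ser_one_def)
  next
    case (Suc k)
    have "(B_ser s \<odot> ser_pow (B_ser s) k) i f \<in> deg_le (K + i)"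
      unfolding neg.mult_eq[OF ser_B neg.ser_ser_pow[OF ser_B]]
    proof (rule deg_le_sum)
      fix d
      have "B_ser s (i - d) (ser_pow (B_ser s) k d f) \<in> deg_le (K + d + (i - d))"
        by (intro deg_le_B_ser Suc.IH)
      then show "B_ser s (i - d) (ser_pow (B_ser s) k d f) \<in> deg_le (K + i)" by simp
    qed
    then show ?case by simp
  qed
  moreover have "EB s i f = (\<Sum>k\<le>nat (- i). scal (1 / fact k) (ser_pow (B_ser s) k i f))"
    by (intro neg.exp_eq ser_B) simp_all
  ultimately show ?thesis by (simp add: deg_le_sum deg_le_scal)
qed

lemma EB_vanish: "f \<in> deg_le K \<Longrightarrow> d < - K \<Longrightarrow> EB s d f = 0"
  using deg_le_negative[OF deg_le_EB] by force

lemma EB_EA_exchange: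
  "EB t (- int a) (EA s b f) =
     (\<Sum>m\<le>a. scal (fps_nth (F_ser t s) m) (EA s (b - int m) (EB t (- int (a - m)) f)))"
proof (rule exp_exchange[where D = "\<lambda>a. EB t (- int a)" and B = "\<lambda>m. B_ser t (- int m)"
      and c = "fps_nth (F_log t s)"])
  show "B_ser t (- int m) (EA s n f) = EA s n (B_ser t (- int m) f) +
      scal (fps_nth (F_log t s) m) (EA s (n - int m) f)" if "m > 0" for m n f
  proof (rule annihilator_exp[where A = "\<lambda>k. A_ser s (int k)"])
    show "B_ser t (- int m) (A_ser s (int k) f) = A_ser s (int k) (B_ser t (- int m) f) +
        (if k = m then scal (fps_nth (F_log t s) m) f else 0)" for k f
      using that by (rule heisenberg_B_A)
  qed (use that in \<open>simp_all add: glin_A_ser glin_B_ser EA_0 EA_negative EA_recursion\<close>)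
  show "of_nat n * fps_nth (F_ser t s) n =
      (\<Sum>k\<le>n. of_nat k * fps_nth (F_log t s) k * fps_nth (F_ser t s) (n - k))" for n
    by (rule fps_deriv_eq_mult_nth) (rule fps_deriv_F_ser)
qed (simp_all only: glin_EA glin_B_ser EB_0 EB_recursion F_ser_nth_0 of_nat_0 minus_zero)

text \<open>
  Any bound \<open>L\<close> beyond which the annihilation part kills \<open>f\<close> makes the defining sum finite.
\<close>

lemma Y_ser_eq:
  assumes "\<And>d. d < - L \<Longrightarrow> EB s d f = 0"
  shows "Y_ser s i f = (\<Sum>d\<in>{-L..0}. EA s (i - d) (EB s d f))"
  unfolding Y_ser_def ser_mult_def
proof (rule Sum_any.expand_superset)
  have "EA s (i - d) (EB s d f) = 0" if "d \<notin> {-L..0}" for d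
    using that assms[of d] EB_positive[of d s f] glin_at_zero[OF glin_EA] by fastforce
  then show "{d. EA s (i - d) (EB s d f) \<noteq> 0} \<subseteq> {-L..0}" by blast
qed simp

lemma normal_YY_eq:
  assumes "f \<in> deg_le K" "K \<ge> 0"
  shows "normal_YY t s (i, j) f =
    (\<Sum>e\<in>{-K..0}. \<Sum>d\<in>{-K..0}. EA t (i - e) (EA s (j - d) (EB t e (EB s d f))))"
proof -
  have serA: "pos2.ser (in_z (A_ser u))" "pos2.ser (in_w (A_ser u))" for u
    unfolding pos2.ser_def in_z_def in_w_def
    by (auto simp: A_ser_def intro!: glin_if glin_A_ser)
  have serB: "neg2.ser (in_z (B_ser u))" "neg2.ser (in_w (B_ser u))" for u
    unfolding neg2.ser_def in_z_def in_w_def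
    by (auto simp: B_ser_def intro!: glin_if glin_B_ser)
  have commute: "commuting (in_z X) (in_z Y)" "commuting (in_z X) (in_w Y)"
      "commuting (in_w X) (in_w Y)"
    if "commuting X Y" "\<And>d. X d 0 = 0" "\<And>d. Y d 0 = 0" for X Y
    using that by (auto simp: commuting_def in_z_def in_w_def)
  note A0 = glin_at_zero[OF glin_A_ser] and B0 = glin_at_zero[OF glin_B_ser]
  have "ser_exp (in_z (A_ser t) \<oplus> in_w (A_ser s)) = ser_exp (in_z (A_ser t)) \<odot> ser_exp (in_w (A_ser s))"
    by (intro pos2.exp_add serA commute commuting_A A0) (simp_all add: in_z_def in_w_def zero_prod_def)
  then have A: "ser_exp (in_z (A_ser t) \<oplus> in_w (A_ser s)) (x, y) g = EA t x (EA s y g)" for x y g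
    by (simp add: in_z_exp in_w_exp A0 in_z_in_w_mult glin_at_zero[OF glin_EA])
  have "ser_exp (in_z (B_ser t) \<oplus> in_w (B_ser s)) = ser_exp (in_z (B_ser t)) \<odot> ser_exp (in_w (B_ser s))"
    by (intro neg2.exp_add serB commute commuting_B B0) (simp_all add: in_z_def in_w_def zero_prod_def)
  then have B: "ser_exp (in_z (B_ser t) \<oplus> in_w (B_ser s)) (x, y) g = EB t x (EB s y g)" for x y g
    by (simp add: in_z_exp in_w_exp B0 in_z_in_w_mult glin_at_zero[OF glin_EB])
  have vanish: "EB t e (EB s d f) = 0" if "\<not> (e \<in> {-K..0} \<and> d \<in> {-K..0})" for e d
  proof (cases "d \<in> {-K..0}")
    case True
    have "EB t e (EB s d f) = 0" if "e < - K"
      using that True EB_vanish[OF deg_le_EB[OF assms(1)], of e d] by simp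
    then show ?thesis using that True EB_positive[of e] by fastforce
  next
    case False
    then have "EB s d f = 0" using EB_vanish[OF assms(1), of d] EB_positive[of d] by fastforce
    then show ?thesis by (simp add: glin_at_zero[OF glin_EB])
  qed
  have "normal_YY t s (i, j) f =
      Sum_any (\<lambda>(e, d). EA t (i - e) (EA s (j - d) (EB t e (EB s d f))))"
    unfolding normal_YY_def ser_mult_def
    by (rule Sum_any.cong) (auto simp: A B)
  also have "\<dots> = (\<Sum>(e, d)\<in>{-K..0} \<times> {-K..0}. EA t (i - e) (EA s (j - d) (EB t e (EB s d f))))"
  proof (rule Sum_any.expand_superset)
    show "{p. (case p of (e, d) \<Rightarrow> EA t (i - e) (EA s (j - d) (EB t e (EB s d f)))) \<noteq> 0}
        \<subseteq> {-K..0} \<times> {-K..0}"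
    proof
      fix p
      assume nz: "p \<in> {p. (case p of (e, d) \<Rightarrow>
        EA t (i - e) (EA s (j - d) (EB t e (EB s d f)))) \<noteq> 0}"
      obtain e d where p: "p = (e, d)" by fastforce
      show "p \<in> {-K..0} \<times> {-K..0}"
      proof (rule ccontr)
        assume "p \<notin> {-K..0} \<times> {-K..0}"
        then have "EB t e (EB s d f) = 0" by (intro vanish) (auto simp: p)
        with nz show False by (simp add: p glin_at_zero[OF glin_EA])
      qed
    qed
  qed simp
  finally show ?thesis by (simp add: sum.cartesian_product)
qed

lemma at_w_over_z_mult:
  "(at_w_over_z G \<odot> N) (i, j) f = Sum_any (\<lambda>m. scal (fps_nth G m) (N (i + int m, j - int m) f))"
proof -
  define h where "h = (\<lambda>m. scal (fps_nth G m) (N (i + int m, j - int m) f))"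
  define p where "p = (\<lambda>m. (i + int m, j - int m))"
  have summand: "at_w_over_z G ((i, j) - q) (N q f) = (if q \<in> range p then h (nat (j - snd q)) else 0)" for q
  proof (cases q)
    case (Pair x y)
    have "q \<in> range p \<longleftrightarrow> j - y \<ge> 0 \<and> i - x = - (j - y)"
    proof
      assume "j - y \<ge> 0 \<and> i - x = - (j - y)"
      then have "q = p (nat (j - y))" by (simp add: Pair p_def)
      then show "q \<in> range p" by blast
    qed (auto simp: Pair p_def)
    then show ?thesis by (auto simp: Pair at_w_over_z_def h_def p_def)
  qed
  have supp: "{q. (if q \<in> range p then h (nat (j - snd q)) else 0) \<noteq> 0} = p ` {m. h m \<noteq> 0}"
    by (auto simp: p_def split: if_splits)
  have "inj p" by (simp add: p_def inj_on_def)
  then have "Sum_any (\<lambda>q. if q \<in> range p then h (nat (j - snd q)) else 0) = Sum_any h"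
    unfolding Sum_any.expand_set supp
    by (subst sum.reindex) (auto simp: p_def inj_on_def)
  then show ?thesis unfolding ser_mult_def summand h_def .
qed

text \<open>
  The product formula for arbitrary parameters.  All sums are restricted to a common finite range,
  given by a degree bound \<open>K\<close> of \<open>f\<close>; the exchange formula then turns the left side into the right side,
  after the substitution of \<open>e + m\<close> for \<open>e\<close>.
\<close>

lemma vertex_operator_product:
  "in_z (Y_ser t) \<odot> in_w (Y_ser s) = at_w_over_z (F_ser t s) \<odot> normal_YY t s"
proof (intro ext)
  fix p :: "int \<times> int" and f :: Gam
  obtain i j where p: "p = (i, j)" by fastforce
  obtain K where K: "K \<ge> 0" "f \<in> deg_le K" using deg_le_exists by blast
  \<comment> \<open>Since \<open>w\<close>-exponents of the normally ordered product applied to \<open>f\<close> are at least \<open>- K\<close>, only powers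
      \<open>m \<le> M\<close> of \<open>w/z\<close> contribute to the coefficient of \<open>w\<^sup>j\<close>.\<close>
  define M where "M = nat (j + K)"
  define L where "L = K + int M"
  \<comment> \<open>The common summand of both sides: \<open>m\<close> is the power of \<open>w/z\<close>, while \<open>e\<close> and \<open>d\<close> are the exponents
      of the two annihilation factors.\<close>
  define \<Phi> where "\<Phi> = (\<lambda>m e d. scal (fps_nth (F_ser t s) m)
      (EA t (i + int m - e) (EA s (j - int m - d) (EB t e (EB s d f)))))"
  define H where "H = (\<Sum>d\<in>{-K..0}. EA s (j - d) (EB s d f))"
  note EA0 = glin_at_zero[OF glin_EA] and EB0 = glin_at_zero[OF glin_EB]

  have inner: "EB t e (EB s d f) = 0" if "e < - K" "d \<le> 0" for e d
    using EB_vanish[OF deg_le_EB[OF K(2)], of e d] that by simp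
  have \<Phi>_zero: "\<Phi> m e d = 0" if "d \<in> {-K..0}" "m > M \<or> e < - K" for m e d
  proof (cases "m > M")
    case True
    then have "j - int m - d < 0" using that(1) by (auto simp: M_def)
    then show ?thesis by (simp add: \<Phi>_def EA_negative EA0)
  next
    case False
    then show ?thesis using that inner[of e d] by (simp add: \<Phi>_def EA0)
  qed

  have summand: "EA t (i - e) (EB t e (EA s (j - d) (EB s d f))) = (\<Sum>m\<le>nat (- e). \<Phi> m (e + int m) d)"
    if "e \<le> 0" for e d
  proof -
    have "EB t e (EA s (j - d) (EB s d f)) = (\<Sum>m\<le>nat (- e). scal (fps_nth (F_ser t s) m)
        (EA s (j - d - int m) (EB t (- int (nat (- e) - m)) (EB s d f))))"
      using EB_EA_exchange[of t "nat (- e)" s "j - d" "EB s d f"] that by simp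
    also have "\<dots> = (\<Sum>m\<le>nat (- e). scal (fps_nth (F_ser t s) m)
        (EA s (j - int m - d) (EB t (e + int m) (EB s d f))))"
    proof (rule sum.cong[OF refl])
      fix m assume "m \<in> {..nat (- e)}"
      then have "- int (nat (- e) - m) = e + int m" "j - d - int m = j - int m - d"
        using that by auto
      then show "scal (fps_nth (F_ser t s) m)
            (EA s (j - d - int m) (EB t (- int (nat (- e) - m)) (EB s d f))) =
          scal (fps_nth (F_ser t s) m) (EA s (j - int m - d) (EB t (e + int m) (EB s d f)))"
        by (simp only:)
    qed
    finally show ?thesis
      by (simp add: \<Phi>_def glin_of_sum[OF glin_EA] glin_scale[OF glin_EA])
  qed

  have "EB t e H = 0" if "e < - L" for e
  proof -
    have "EB t e (EA s (j - d) (EB s d f)) = 0" if d: "d \<in> {-K..0}" for d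
    proof -
      have "scal (fps_nth (F_ser t s) m)
          (EA s (j - d - int m) (EB t (- int (nat (- e) - m)) (EB s d f))) = 0"
        if "m \<le> nat (- e)" for m
      proof (cases "m > M")
        case True
        then have "j - d - int m < 0" using d by (auto simp: M_def)
        then show ?thesis by (simp add: EA_negative)
      next
        case False
        then have "- int (nat (- e) - m) < - K" using \<open>e < - L\<close> that K(1) by (auto simp: L_def)
        then show ?thesis using d by (simp add: inner EA0)
      qed
      moreover have "e \<le> 0" using that \<open>e < - L\<close> K(1) by (simp add: L_def)
      ultimately show ?thesis
        using EB_EA_exchange[of t "nat (- e)" s "j - d" "EB s d f"] by simp
    qed
    then show ?thesis by (simp add: H_def glin_of_sum[OF glin_EB])
  qed
  then have "Y_ser t i H = (\<Sum>e\<in>{-L..0}. EA t (i - e) (EB t e H))"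
    by (rule Y_ser_eq)
  also have "\<dots> = (\<Sum>e\<in>{-L..0}. \<Sum>d\<in>{-K..0}. \<Sum>m\<le>nat (- e). \<Phi> m (e + int m) d)"
    by (simp add: H_def glin_of_sum[OF glin_EB] glin_of_sum[OF glin_EA] summand)
  also have "\<dots> = (\<Sum>d\<in>{-K..0}. \<Sum>e\<in>{-L..0}. \<Sum>m\<le>nat (- e). \<Phi> m (e + int m) d)"
    by (rule sum.swap)
  also have "\<dots> = (\<Sum>d\<in>{-K..0}. \<Sum>m\<le>M. \<Sum>e\<in>{-K..0}. \<Phi> m e d)"
  proof (rule sum.cong[OF refl])
    fix d assume d: "d \<in> {-K..0}"
    show "(\<Sum>e\<in>{-L..0}. \<Sum>m\<le>nat (- e). \<Phi> m (e + int m) d) = (\<Sum>m\<le>M. \<Sum>e\<in>{-K..0}. \<Phi> m e d)"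
      unfolding sum.cartesian_product
        sum.Sigma[OF finite_atLeastAtMost_int ballI[OF finite_atMost]]
      by (rule sum.reindex_bij_witness_not_neutral[where
            S' = "{(e, m). m > M \<or> e + int m < - K} \<inter> (SIGMA e:{-L..0}. {..nat (- e)})" and T' = "{}"
            and j = "\<lambda>(e, m). (m, e + int m)" and i = "\<lambda>(m, e). (e - int m, m)"])
        (use d in \<open>auto simp: \<Phi>_zero L_def\<close>)
  qed
  also have "\<dots> = (\<Sum>m\<le>M. \<Sum>d\<in>{-K..0}. \<Sum>e\<in>{-K..0}. \<Phi> m e d)"
    by (rule sum.swap)
  also have "\<dots> = (\<Sum>m\<le>M. \<Sum>e\<in>{-K..0}. \<Sum>d\<in>{-K..0}. \<Phi> m e d)"
    by (intro sum.cong refl sum.swap)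
  finally have lhs: "Y_ser t i H = (\<Sum>m\<le>M. \<Sum>e\<in>{-K..0}. \<Sum>d\<in>{-K..0}. \<Phi> m e d)" .

  have normal: "scal (fps_nth (F_ser t s) m) (normal_YY t s (i + int m, j - int m) f) =
      (\<Sum>e\<in>{-K..0}. \<Sum>d\<in>{-K..0}. \<Phi> m e d)" for m
    unfolding normal_YY_eq[OF K(2,1)] \<Phi>_def by (simp add: gam.scale_sum_right)
  define S where "S = (\<lambda>m. \<Sum>e\<in>{-K..0}. \<Sum>d\<in>{-K..0}. \<Phi> m e d)"
  have S_zero: "S m = 0" if "m > M" for m
    using that by (simp add: S_def \<Phi>_zero)
  have "(at_w_over_z (F_ser t s) \<odot> normal_YY t s) p f = Sum_any S"
    unfolding p at_w_over_z_mult normal S_def ..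
  also have "\<dots> = sum S {..M}"
    by (rule Sum_any.expand_superset) (use S_zero in \<open>auto simp: not_less[symmetric]\<close>)
  also have "\<dots> = Y_ser t i H" by (simp only: lhs S_def)
  also have "H = Y_ser s j f"
    unfolding H_def by (rule Y_ser_eq[symmetric]) (rule EB_vanish[OF K(2)])
  also have "Y_ser t i (Y_ser s j f) = (in_z (Y_ser t) \<odot> in_w (Y_ser s)) p f"
  proof -
    have "Y_ser t d 0 = 0" for d by (simp add: Y_ser_def ser_mult_def EB0 EA0)
    then show ?thesis by (simp add: p in_z_in_w_mult)
  qed
  finally show "(in_z (Y_ser t) \<odot> in_w (Y_ser s)) p f =
      (at_w_over_z (F_ser t s) \<odot> normal_YY t s) p f" ..
qed

theorem theorem4p1:
  fixes M :: nat
  assumes "M \<ge> 1"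
  shows "in_z (Y_ser indet) \<odot> in_w (Y_ser (indet ^ M)) =
           at_w_over_z (qpoch fps_X (fps_const indet) M / qpoch (- fps_X) (fps_const indet) M)
             \<odot> normal_YY indet (indet ^ M) \<and>
         F_ser indet (indet ^ M) =
           (\<Prod>j<M. (1 - fps_const (indet ^ j) * fps_X) / (1 + fps_const (indet ^ j) * fps_X)) \<and>
         (\<Prod>j<M. (1 - fps_const (indet ^ j) * fps_X) / (1 + fps_const (indet ^ j) * fps_X)) =
           qpoch fps_X (fps_const indet) M / qpoch (- fps_X) (fps_const indet) M"
  by (intro conjI)
    (simp_all only: vertex_operator_product F_ser_indet prod_eq_qpoch_quotient)

end
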